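(* Let $\mathfrak{M}_{14}=(\mathbb{R}^{14},\langle\cdot,\cdot\rangle,A)$ be the $0$-model defined in the context. Then: (1) $\mathfrak{M}_{14}$ is Jacobi--Tsankov of signature $(8,6)$. (2) $\mathfrak{M}_{14}$ is neither $2$-step Jacobi nilpotent nor skew-Tsankov. (3) There is a short exact sequence $1\rightarrow\mathbb{R}^{21}\rightarrow\mathcal{G}(\mathfrak{M}_{14})\rightarrow SL_\pm(3)\rightarrow 1$. (4) $\mathfrak{M}_{14}$ is mixed-Tsankov.
   Context: An algebraic curvature tensor on a real vector space $V$ is $A\in\otimes^4V^*$ with $A(v_1,v_2,v_3,v_4)=-A(v_2,v_1,v_3,v_4)=A(v_3,v_4,v_1,v_2)$ and $A(v_1,v_2,v_3,v_4)+A(v_2,v_3,v_1,v_4)+A(v_3,v_1,v_2,v_4)=0$. A $0$-model is a triple $(V,\langle\cdot,\cdot\rangle,A)$ with $V$ finite dimensional, $\langle\cdot,\cdot\rangle$ a non-degenerate symmetric inner product of signature $(p,q)$ ($p$ negative and $q$ positive directions) and $A$ an algebraic curvature tensor. Define $\mathcal{A}(x,y)$ by $\langle\mathcal{A}(x,y)z,w\rangle=A(x,y,z,w)$ and $\mathcal{J}(x)y:=\mathcal{A}(y,x)x$. The model is: Jacobi--Tsankov if $\mathcal{J}(x)\mathcal{J}(y)=\mathcal{J}(y)\mathcal{J}(x)$ for all $x,y$; $2$-step Jacobi nilpotent if $\mathcal{J}(x)\mathcal{J}(y)=0$ for all $x,y$; skew-Tsankov if $\mathcal{A}(x_1,x_2)\mathcal{A}(x_3,x_4)=\mathcal{A}(x_3,x_4)\mathcal{A}(x_1,x_2)$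 for all $x_i$; mixed-Tsankov if $\mathcal{A}(x_1,x_2)\mathcal{J}(x_3)=\mathcal{J}(x_3)\mathcal{A}(x_1,x_2)$ for all $x_i$. The model $\mathfrak{M}_{14}$: let $\{\alpha_i,\alpha_i^*,\beta_{i,1},\beta_{i,2},\beta_{4,1},\beta_{4,2}\}$, $1\le i\le 3$, be a basis of $\mathbb{R}^{14}$. The non-zero components of $\langle\cdot,\cdot\rangle$ and $A$ are, up to the usual symmetries: $\langle\alpha_i,\alpha_i^*\rangle=\langle\beta_{i,1},\beta_{i,2}\rangle=1$ for $1\le i\le3$; $\langle\beta_{4,1},\beta_{4,1}\rangle=\langle\beta_{4,2},\beta_{4,2}\rangle=-\frac12$; $\langle\beta_{4,1},\beta_{4,2}\rangle=\frac14$; $A(\alpha_2,\alpha_1,\alpha_1,\beta_{2,1})=A(\alpha_3,\alpha_1,\alpha_1,\beta_{3,1})=1$; $A(\alpha_3,\alpha_2,\alpha_2,\beta_{3,2})=A(\alpha_1,\alpha_2,\alpha_2,\beta_{1,2})=1$; $A(\alpha_1,\alpha_3,\alpha_3,\beta_{1,1})=A(\alpha_2,\alpha_3,\alpha_3,\beta_{2,2})=1$; $A(\alpha_1,\alpha_2,\alpha_3,\beta_{4,1})=A(\alpha_1,\alpha_3,\alpha_2,\beta_{4,1})=-\frac12$; $A(\alpha_2,\alpha_3,\alpha_1,\beta_{4,2})=A(\alpha_2,\alpha_1,\alpha_3,\beta_{4,2})=-\frac12$. $\mathcal{G}(\mathfrak{M}_{14})$ is the group of all $T\in GL(\mathbb{R}^{14})$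 with $T^*\langle\cdot,\cdot\rangle=\langle\cdot,\cdot\rangle$ and $T^*A=A$. $SL_\pm(3):=\{B\in GL(\mathbb{R}^3):\det(B)=\pm1\}$.
   Formalization: In (3), R^21 is not the additive group (the kernel is non-abelian, so the claim is false as stated); it is R^21 with some law x+y+ω(x,y), ω bilinear alternating with ω(ω(x,y),z)=0, and both maps in the sequence are continuous. *)

theory Defs
  imports "HOL-Analysis.Analysis" "HOL-Algebra.Coset"
begin

section \<open>0-models\<close>

definition multilinear4 :: "('a::real_vector \<Rightarrow> 'a \<Rightarrow> 'a \<Rightarrow> 'a \<Rightarrow> real) \<Rightarrow> bool" where
  "multilinear4 A \<longleftrightarrow>
     (\<forall>y z w. linear (\<lambda>x. A x y z w)) \<and> (\<forall>x z w. linear (\<lambda>y. A x y z w)) \<and>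
     (\<forall>x y w. linear (\<lambda>z. A x y z w)) \<and> (\<forall>x y z. linear (\<lambda>w. A x y z w))"

definition algebraic_curvature_tensor :: "('a::real_vector \<Rightarrow> 'a \<Rightarrow> 'a \<Rightarrow> 'a \<Rightarrow> real) \<Rightarrow> bool" where
  "algebraic_curvature_tensor A \<longleftrightarrow>
     multilinear4 A \<and>
     (\<forall>x y z w. A x y z w = - A y x z w) \<and>
     (\<forall>x y z w. A x y z w = A z w x y) \<and>
     (\<forall>x y z w. A x y z w + A y z x w + A z x y w = 0)"

definition zero_model ::
  "('a::real_vector \<Rightarrow> 'a \<Rightarrow> real) \<Rightarrow> ('a \<Rightarrow> 'a \<Rightarrow> 'a \<Rightarrow> 'a \<Rightarrow> real) \<Rightarrow> bool" where
  "zero_model g A \<longleftrightarrow>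
     (\<exists>B::'a set. finite B \<and> span B = UNIV) \<and>
     bilinear g \<and> (\<forall>x y. g x y = g y x) \<and> (\<forall>x. (\<forall>y. g x y = 0) \<longrightarrow> x = 0) \<and>
     algebraic_curvature_tensor A"

text \<open>Signature $(p,q)$: some orthogonal basis has \<open>p\<close> negative and \<open>q\<close> positive vectors.\<close>

definition has_signature :: "('a::real_vector \<Rightarrow> 'a \<Rightarrow> real) \<Rightarrow> nat \<Rightarrow> nat \<Rightarrow> bool" where
  "has_signature g p q \<longleftrightarrow>
     (\<exists>N P. finite N \<and> finite P \<and> card N = p \<and> card P = q \<and>
        independent (N \<union> P) \<and> span (N \<union> P) = UNIV \<and>
        (\<forall>x\<in>N \<union> P. \<forall>y\<in>N \<union> P. x \<noteq> y \<longrightarrow> g x y = 0) \<and>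
        (\<forall>x\<in>N. g x x < 0) \<and> (\<forall>x\<in>P. g x x > 0))"

text \<open>The description is unique, and satisfiable, because \<open>g\<close> is non-degenerate on a
  finite-dimensional space.\<close>

definition curvature_operator ::
  "('a::real_vector \<Rightarrow> 'a \<Rightarrow> real) \<Rightarrow> ('a \<Rightarrow> 'a \<Rightarrow> 'a \<Rightarrow> 'a \<Rightarrow> real) \<Rightarrow> 'a \<Rightarrow> 'a \<Rightarrow> 'a \<Rightarrow> 'a" where
  "curvature_operator g A x y z = (THE u. \<forall>w. g u w = A x y z w)"

definition jacobi_operator ::
  "('a::real_vector \<Rightarrow> 'a \<Rightarrow> real) \<Rightarrow> ('a \<Rightarrow> 'a \<Rightarrow> 'a \<Rightarrow> 'a \<Rightarrow> real) \<Rightarrow> 'a \<Rightarrow> 'a \<Rightarrow> 'a" where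
  "jacobi_operator g A x y = curvature_operator g A y x x"

definition jacobi_tsankov ::
  "('a::real_vector \<Rightarrow> 'a \<Rightarrow> real) \<Rightarrow> ('a \<Rightarrow> 'a \<Rightarrow> 'a \<Rightarrow> 'a \<Rightarrow> real) \<Rightarrow> bool" where
  "jacobi_tsankov g A \<longleftrightarrow>
     (\<forall>x y. jacobi_operator g A x \<circ> jacobi_operator g A y =
            jacobi_operator g A y \<circ> jacobi_operator g A x)"

definition two_step_jacobi_nilpotent ::
  "('a::real_vector \<Rightarrow> 'a \<Rightarrow> real) \<Rightarrow> ('a \<Rightarrow> 'a \<Rightarrow> 'a \<Rightarrow> 'a \<Rightarrow> real) \<Rightarrow> bool" where
  "two_step_jacobi_nilpotent g A \<longleftrightarrow>
     (\<forall>x y. jacobi_operator g A x \<circ> jacobi_operator g A y = (\<lambda>_. 0))"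

definition skew_tsankov ::
  "('a::real_vector \<Rightarrow> 'a \<Rightarrow> real) \<Rightarrow> ('a \<Rightarrow> 'a \<Rightarrow> 'a \<Rightarrow> 'a \<Rightarrow> real) \<Rightarrow> bool" where
  "skew_tsankov g A \<longleftrightarrow>
     (\<forall>x1 x2 x3 x4. curvature_operator g A x1 x2 \<circ> curvature_operator g A x3 x4 =
                    curvature_operator g A x3 x4 \<circ> curvature_operator g A x1 x2)"

definition mixed_tsankov ::
  "('a::real_vector \<Rightarrow> 'a \<Rightarrow> real) \<Rightarrow> ('a \<Rightarrow> 'a \<Rightarrow> 'a \<Rightarrow> 'a \<Rightarrow> real) \<Rightarrow> bool" where
  "mixed_tsankov g A \<longleftrightarrow>
     (\<forall>x1 x2 x3. curvature_operator g A x1 x2 \<circ> jacobi_operator g A x3 =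
                 jacobi_operator g A x3 \<circ> curvature_operator g A x1 x2)"


section \<open>The model $M_{14}$\<close>

text \<open>Labels of the basis vectors: \<open>\<alpha>s i\<close> stands for $\alpha_i^*$, and \<open>\<beta>ij\<close> for $\beta_{i,j}$.\<close>

datatype idx14 =
    \<alpha>1 | \<alpha>2 | \<alpha>3 | \<alpha>s1 | \<alpha>s2 | \<alpha>s3
  | \<beta>11 | \<beta>12 | \<beta>21 | \<beta>22 | \<beta>31 | \<beta>32 | \<beta>41 | \<beta>42

text \<open>The coordinate of \<open>x\<close> along \<open>e i\<close>, for a basis \<open>e\<close>.\<close>

definition coord :: "('i \<Rightarrow> 'a::real_vector) \<Rightarrow> 'i \<Rightarrow> 'a \<Rightarrow> real" where
  "coord e i x = representation (range e) x (e i)"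

text \<open>The symmetric form whose only non-zero component up to symmetry is
  $\langle e_i,e_j\rangle=1$, for \<open>i \<noteq> j\<close>.\<close>

definition form_component :: "('i \<Rightarrow> 'a::real_vector) \<Rightarrow> 'i \<Rightarrow> 'i \<Rightarrow> 'a \<Rightarrow> 'a \<Rightarrow> real" where
  "form_component e i j x y = coord e i x * coord e j y + coord e j x * coord e i y"

text \<open>The tensor with component \<open>1\<close> at \<open>(i, j, k, l)\<close>, the components forced by
  $A(x,y,z,w)=-A(y,x,z,w)=A(z,w,x,y)$, and no others. This normalization needs \<open>i \<noteq> j\<close>,
  \<open>k \<noteq> l\<close> and \<open>{i, j} \<noteq> {k, l}\<close>. The Bianchi identity holds only for the
  sum of the components of $M_{14}$, not for each of them separately.\<close>

definition curvature_component ::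
  "('i \<Rightarrow> 'a::real_vector) \<Rightarrow> 'i \<Rightarrow> 'i \<Rightarrow> 'i \<Rightarrow> 'i \<Rightarrow> 'a \<Rightarrow> 'a \<Rightarrow> 'a \<Rightarrow> 'a \<Rightarrow> real" where
  "curvature_component e i j k l x y z w =
     (coord e i x * coord e j y - coord e j x * coord e i y) *
     (coord e k z * coord e l w - coord e l z * coord e k w) +
     (coord e k x * coord e l y - coord e l x * coord e k y) *
     (coord e i z * coord e j w - coord e j z * coord e i w)"

definition M14_form :: "(idx14 \<Rightarrow> 'a::real_vector) \<Rightarrow> 'a \<Rightarrow> 'a \<Rightarrow> real" where
  "M14_form e x y =
     form_component e \<alpha>1 \<alpha>s1 x y + form_component e \<alpha>2 \<alpha>s2 x y + form_component e \<alpha>3 \<alpha>s3 x y +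
     form_component e \<beta>11 \<beta>12 x y + form_component e \<beta>21 \<beta>22 x y + form_component e \<beta>31 \<beta>32 x y
     - 1/2 * (coord e \<beta>41 x * coord e \<beta>41 y) - 1/2 * (coord e \<beta>42 x * coord e \<beta>42 y)
     + 1/4 * form_component e \<beta>41 \<beta>42 x y"

definition M14_curvature :: "(idx14 \<Rightarrow> 'a::real_vector) \<Rightarrow> 'a \<Rightarrow> 'a \<Rightarrow> 'a \<Rightarrow> 'a \<Rightarrow> real" where
  "M14_curvature e x y z w =
     curvature_component e \<alpha>2 \<alpha>1 \<alpha>1 \<beta>21 x y z w + curvature_component e \<alpha>3 \<alpha>1 \<alpha>1 \<beta>31 x y z w +
     curvature_component e \<alpha>3 \<alpha>2 \<alpha>2 \<beta>32 x y z w + curvature_component e \<alpha>1 \<alpha>2 \<alpha>2 \<beta>12 x y z w +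
     curvature_component e \<alpha>1 \<alpha>3 \<alpha>3 \<beta>11 x y z w + curvature_component e \<alpha>2 \<alpha>3 \<alpha>3 \<beta>22 x y z w
     - 1/2 * curvature_component e \<alpha>1 \<alpha>2 \<alpha>3 \<beta>41 x y z w
     - 1/2 * curvature_component e \<alpha>1 \<alpha>3 \<alpha>2 \<beta>41 x y z w
     - 1/2 * curvature_component e \<alpha>2 \<alpha>3 \<alpha>1 \<beta>42 x y z w
     - 1/2 * curvature_component e \<alpha>2 \<alpha>1 \<alpha>3 \<beta>42 x y z w"


section \<open>Groups and exact sequences\<close>

definition model_group ::
  "(real^'n \<Rightarrow> real^'n \<Rightarrow> real) \<Rightarrow> (real^'n \<Rightarrow> real^'n \<Rightarrow> real^'n \<Rightarrow> real^'n \<Rightarrow> real)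
    \<Rightarrow> (real^'n^'n) monoid" where
  "model_group g A =
     \<lparr>carrier = {T. invertible T \<and>
                   (\<forall>x y. g (T *v x) (T *v y) = g x y) \<and>
                   (\<forall>x y z w. A (T *v x) (T *v y) (T *v z) (T *v w) = A x y z w)},
      mult = (**), one = mat 1\<rparr>"

definition SL_pm :: "(real^'n^'n) monoid" where
  "SL_pm = \<lparr>carrier = {B. invertible B \<and> (det B = 1 \<or> det B = -1)}, mult = (**), one = mat 1\<rparr>"

text \<open>Exactness of $1\to K\to G\to Q\to 1$. The library's \<open>short_exact_sequence\<close> requires all
  groups to live on the same type.\<close>

definition group_short_exact ::
  "'a monoid \<Rightarrow> ('a \<Rightarrow> 'b) \<Rightarrow> 'b monoid \<Rightarrow> ('b \<Rightarrow> 'c) \<Rightarrow> 'c monoid \<Rightarrow> bool" where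
  "group_short_exact K f G h Q \<longleftrightarrow>
     group K \<and> group G \<and> group Q \<and> f \<in> mon K G \<and> h \<in> epi G Q \<and>
     f ` carrier K = kernel G Q h"

text \<open>Simply connected Lie groups of nilpotency class at most two, in exponential coordinates:
  for a bracket \<open>2 \<omega>\<close> on a vector space, with all double brackets zero, the
  Baker--Campbell--Hausdorff product is \<open>x + y + \<omega> x y\<close>. Zero is neutral, \<open>- x\<close> is the inverse
  of \<open>x\<close>, every line through zero is a one-parameter subgroup, and \<open>\<omega> = 0\<close> gives the additive
  group.

  The $\mathbb{R}^{21}$ in the exact sequence for $M_{14}$ has to be read in this way: the elements
  of the symmetry group acting trivially on the quotient by $\mathrm{span}\{\beta_{i,j},\alpha_i^*\}$
  form a group diffeomorphic to $\mathbb{R}^{21}$ which is not commutative, so no exact sequence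
  with the additive group $\mathbb{R}^{21}$ exists.\<close>

definition class_two_bracket :: "('a::real_vector \<Rightarrow> 'a \<Rightarrow> 'a) \<Rightarrow> bool" where
  "class_two_bracket \<omega> \<longleftrightarrow>
     bilinear \<omega> \<and> (\<forall>x. \<omega> x x = 0) \<and> (\<forall>x y z. \<omega> (\<omega> x y) z = 0)"

definition class_two_group :: "('a::real_vector \<Rightarrow> 'a \<Rightarrow> 'a) \<Rightarrow> 'a monoid" where
  "class_two_group \<omega> = \<lparr>carrier = UNIV, mult = (\<lambda>x y. x + y + \<omega> x y), one = 0\<rparr>"

end

theory Submission
  imports Defs
begin

text \<open>The model is $V = U \oplus \mathfrak{sl}(3) \oplus U^*$ with $U = \mathbb{R}^3$: the eight vectors
  $\beta_{i,j}$ form a basis of the traceless matrices, the inner product is the duality pairing of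
  $U$ and $U^*$ minus the trace form, and for $M \in \mathfrak{sl}(3)$ the curvature is
  $A(x,y,z,M) = \mathrm{vol}(x,y,Mz)$; the Bianchi identity says that $M$ is traceless. All curvature
  operators map $U$ to $\mathfrak{sl}(3) \oplus U^*$, $\mathfrak{sl}(3)$ to $U^*$ and $U^*$ to $0$, so the
  commutation properties reduce to identities for triple products.

  A symmetry preserves the kernel $U^*$ of $A$ and its orthogonal complement, so it induces
  $P \in GL(U)$. It acts on $\mathfrak{sl}(3)$ by $M \mapsto \det(P)^{-1} P M P^{-1}$, and this is isometric
  only for $\det(P)^2 = 1$. If $P = 1$ the symmetry is the exponential of a nilpotent $N$ given by a
  linear map $L : U \to \mathfrak{sl}(3)$ and a vector $s$, with
  $N(u,M,\varphi) = (0, L u, L^\dagger M + s \times u)$. Invariance of $A$ means that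
  $L(w)z - L(z)w = t \times (z \times w)$ for some $t$, and as $L$ takes traceless values, $t$ is determined
  by the symmetric part of $(z,w) \mapsto L(w)z$, which is arbitrary. This gives $18 + 3 = 21$
  parameters.\<close>

section \<open>Linear algebra in dimension three\<close>

unbundle cross3_syntax

text \<open>The three terms are vol(a,b,Mc), vol(Ma,b,c) and vol(a,Mb,c): this is the derivative of
  the determinant in the direction \<open>M\<close>. It is the source of the Bianchi
  identity.\<close>

lemma triple_cyclic_trace:
  fixes M :: "real^3^3"
  shows "(a \<times> b) \<bullet> (M *v c) + (b \<times> c) \<bullet> (M *v a) + (c \<times> a) \<bullet> (M *v b)
           = trace M * ((a \<times> b) \<bullet> c)"
  by (simp only: cross3_def inner_vec_def sum_3 matrix_vector_mult_def trace_def vec_lambda_beta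
      vector_3 inner_real_def) algebra

definition outer :: "real^3 \<Rightarrow> real^3 \<Rightarrow> real^3^3" where
  "outer a b = (\<chi> i j. a $ i * b $ j)"

lemma outer_mult_vec [simp]: "outer a b *v c = (b \<bullet> c) *\<^sub>R a"
  by (simp add: outer_def vec_eq_iff matrix_vector_mult_def inner_vec_def sum_distrib_left
      sum_distrib_right mult_ac)

lemma transpose_outer [simp]: "transpose (outer a b) = outer b a"
  by (simp add: outer_def transpose_def vec_eq_iff)

lemma vec_mult_outer [simp]: "c v* outer a b = (a \<bullet> c) *\<^sub>R b"
  by (metis outer_mult_vec transpose_matrix_vector transpose_outer)

lemma outer_0 [simp]: "outer 0 b = 0" "outer a 0 = 0"
  by (simp_all add: outer_def vec_eq_iff)

lemma vec_matrix_mult_minus: "c v* (M - M') = c v* M - c v* (M' :: real^'n^'m)"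
  by (simp add: vec_eq_iff vector_matrix_mult_def algebra_simps sum_subtractf)

lemma vec_matrix_mult_scaleR: "c v* (r *\<^sub>R M) = r *\<^sub>R (c v* (M :: real^'n^'m))"
  by (simp add: vec_eq_iff vector_matrix_mult_def sum_distrib_left mult_ac)

lemma uminus_mult_vec [simp]: "(- M) *v x = - (M *v (x :: real^'n))"
  by (simp add: vec_eq_iff matrix_vector_mult_def sum_negf)

lemma vec_mult_uminus [simp]: "x v* (- M) = - ((x :: real^'n) v* M)"
  by (simp add: vec_eq_iff vector_matrix_mult_def sum_negf)

lemma trace_outer [simp]: "trace (outer a b) = a \<bullet> b"
  by (simp add: outer_def trace_def inner_vec_def)

lemma trace_outer_mult [simp]: "trace (outer a b ** M) = b \<bullet> (M *v a)"
  by (simp add: outer_def trace_def inner_vec_def matrix_matrix_mult_def matrix_vector_mult_def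
      sum_3 algebra_simps)

lemma trace_scaleR: "trace (c *\<^sub>R M) = c * trace (M :: real^'n^'n)"
  by (simp add: trace_def sum_distrib_left)

lemma trace_scaleR_mult:
  "trace ((c *\<^sub>R M) ** M') = c * trace (M ** (M' :: real^'n^'n))"
  "trace (M ** (c *\<^sub>R M')) = c * trace (M ** (M' :: real^'n^'n))"
  by (simp_all add: trace_def matrix_matrix_mult_def sum_distrib_left mult_ac)

lemma scaleR_mult_vec: "(c *\<^sub>R M) *v x = c *\<^sub>R (M *v (x :: real^'n))"
  by (simp add: vec_eq_iff matrix_vector_mult_def sum_distrib_left mult_ac)

lemma trace_mat_1_mult [simp]: "trace ((c *\<^sub>R mat 1) ** M) = c * trace (M :: real^'n^'n)"
  by (simp add: trace_scaleR_mult)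

lemma matrix_add_rdistrib: "(M + M') ** N = M ** N + M' ** (N :: real^'n^'n)"
  by (simp add: vec_eq_iff matrix_matrix_mult_def sum.distrib algebra_simps)

lemma matrix_diff_rdistrib: "(M - M') ** N = M ** N - M' ** (N :: real^'n^'n)"
  by (simp add: vec_eq_iff matrix_matrix_mult_def sum_subtractf algebra_simps)

section \<open>Curvature operators\<close>

text \<open>The splitting is kept abstract: \<open>u\<close>, \<open>m\<close>, \<open>p\<close> are
  the components in U, sl(3) and the dual of U, and \<open>mk\<close> reassembles a vector from
  components with traceless matrix.\<close>

locale sl3_model =
  fixes u :: "real^'n \<Rightarrow> real^3" and m :: "real^'n \<Rightarrow> real^3^3" and p :: "real^'n \<Rightarrow> real^3"
    and mk :: "real^3 \<Rightarrow> real^3^3 \<Rightarrow> real^3 \<Rightarrow> real^'n"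
  assumes linear_u: "linear u" and linear_m: "linear m" and linear_p: "linear p"
    and trace_m [simp]: "trace (m x) = 0"
    and u_mk [simp]: "trace M = 0 \<Longrightarrow> u (mk a M b) = a"
    and m_mk [simp]: "trace M = 0 \<Longrightarrow> m (mk a M b) = M"
    and p_mk [simp]: "trace M = 0 \<Longrightarrow> p (mk a M b) = b"
    and eqI: "u x = u y \<Longrightarrow> m x = m y \<Longrightarrow> p x = p y \<Longrightarrow> x = y"
begin

definition g :: "real^'n \<Rightarrow> real^'n \<Rightarrow> real" where
  "g x y = p x \<bullet> u y + p y \<bullet> u x - trace (m x ** m y)"

text \<open>Each argument in turn supplies the matrix in vol(x,y,Mz); the signs are those forced by
  the curvature symmetries.\<close>

definition A :: "real^'n \<Rightarrow> real^'n \<Rightarrow> real^'n \<Rightarrow> real^'n \<Rightarrow> real" where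
  "A x y z w = (u x \<times> u y) \<bullet> (m w *v u z) - (u x \<times> u y) \<bullet> (m z *v u w)
             + (u z \<times> u w) \<bullet> (m y *v u x) - (u z \<times> u w) \<bullet> (m x *v u y)"

lemmas lin_simps [simp] =
  linear_add[OF linear_u] linear_add[OF linear_m] linear_add[OF linear_p]
  linear_cmul[OF linear_u] linear_cmul[OF linear_m] linear_cmul[OF linear_p]
  linear_0[OF linear_u] linear_0[OF linear_m] linear_0[OF linear_p]
  linear_diff[OF linear_u] linear_diff[OF linear_m] linear_diff[OF linear_p]

lemma linear_mk:
  assumes "linear f" "linear F" "linear k" "\<And>v. trace (F v) = 0"
  shows "linear (\<lambda>v. mk (f v) (F v) (k v))"
  by (rule linearI; rule eqI)
     (use assms(4) in \<open>auto simp: linear_add[OF assms(1)] linear_add[OF assms(2)]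
       linear_add[OF assms(3)] linear_cmul[OF assms(1)] linear_cmul[OF assms(2)]
       linear_cmul[OF assms(3)] trace_add trace_scaleR\<close>)

lemma trace_zero [simp]: "trace (0 :: real^3^3) = 0"
  by (simp add: trace_def)

lemma bilinear_g: "bilinear g"
  unfolding bilinear_def g_def
  apply (intro conjI allI linearI)
  apply (simp_all only: lin_simps inner_add_left inner_add_right trace_add trace_scaleR_mult
      matrix_add_ldistrib matrix_add_rdistrib inner_scaleR_left inner_scaleR_right real_scaleR_def)
  apply (simp_all add: Rings.ring_distribs)
  done

lemma g_commute: "g x y = g y x"
  using trace_mul_sym[of "m x" "m y"] by (simp add: g_def)

lemma g_nondegenerate:
  assumes "\<And>y. g x y = 0" shows "x = 0"
proof (rule eqI)
  have "b \<bullet> u x = 0" for b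
    using assms[of "mk 0 0 b"] by (simp add: g_def)
  then show u: "u x = u 0" by (metis inner_eq_zero_iff lin_simps(7))
  have "p x \<bullet> a = 0" for a
    using assms[of "mk a 0 0"] by (simp add: g_def)
  then show "p x = p 0" by (metis inner_eq_zero_iff lin_simps(9))
  have "m x = 0"
  proof -
    have *: "trace (m x ** M) = 0" if "trace M = 0" for M
      using assms[of "mk 0 M 0"] that by (simp add: g_def)
    \<comment> \<open>\<open>m x\<close> is trace-orthogonal to scalar matrices, so the test extends
      from traceless matrices to all.\<close>
    have "trace (m x ** M) = 0" for M
    proof -
      have "trace ((M - (trace M / 3) *\<^sub>R mat 1) ** m x) = trace (M ** m x)"
        by (simp add: matrix_diff_rdistrib trace_sub)
      moreover have "trace (M - (trace M / 3) *\<^sub>R mat 1) = 0"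
        by (simp add: trace_sub trace_scaleR trace_I)
      ultimately show ?thesis
        using *[of "M - (trace M / 3) *\<^sub>R mat 1"] by (metis trace_mul_sym)
    qed
    \<comment> \<open>Against the transpose, the trace form gives the sum of the squared
      entries.\<close>
    from this[of "transpose (m x)"] have "(\<Sum>i\<in>UNIV. \<Sum>j\<in>UNIV. (m x $ i $ j)\<^sup>2) = 0"
      by (simp add: trace_def matrix_matrix_mult_def transpose_def power2_eq_square)
    then show ?thesis
      by (simp add: sum_nonneg_eq_0_iff sum_nonneg vec_eq_iff)
  qed
  then show "m x = m 0" by simp
qed

lemma multilinear_A: "multilinear4 A"
  unfolding multilinear4_def A_def
  apply (intro conjI allI linearI)
  apply (simp_all only: lin_simps cross_add_left cross_add_right cross_mult_left cross_mult_right
      inner_add_left inner_add_right matrix_vector_right_distrib matrix_vector_mult_add_rdistrib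
      matrix_vector_mult_scaleR scaleR_mult_vec inner_scaleR_left inner_scaleR_right real_scaleR_def
      distrib_left Rings.ring_distribs)
  done

lemma curvature_A: "algebraic_curvature_tensor A"
proof -
  have "A x y z w = - A y x z w" for x y z w
    using cross_skew[of "u x" "u y"] by (simp add: A_def)
  moreover have "A x y z w = A z w x y" for x y z w
    by (simp add: A_def)
  \<comment> \<open>One trace identity for each argument that supplies the matrix; the right-hand
    sides vanish by \<open>trace_m\<close>.\<close>
  moreover have "A x y z w + A y z x w + A z x y w = 0" for x y z w
    using triple_cyclic_trace[of "u x" "u y" "m w" "u z"]
      triple_cyclic_trace[of "u x" "u y" "m z" "u w"]
      triple_cyclic_trace[of "u y" "u z" "m x" "u w"]
      triple_cyclic_trace[of "u z" "u x" "m y" "u w"]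
      cross_skew[of "u w" "u x"] cross_skew[of "u w" "u y"] cross_skew[of "u w" "u z"]
    by (simp add: A_def)
  ultimately show ?thesis
    unfolding algebraic_curvature_tensor_def using multilinear_A by blast
qed

lemma zero_model: "zero_model g A"
  unfolding zero_model_def
proof (intro conjI)
  show "\<exists>B::(real^'n) set. finite B \<and> span B = UNIV"
    using finite_Basis span_Basis by blast
qed (use bilinear_g g_commute g_nondegenerate curvature_A in auto)

text \<open>Solves \<open>g (R x y z) w = A x y z w\<close> by components: \<open>A\<close> contains
  no \<open>p w\<close>, so the U-part is 0; the coefficient of \<open>m w\<close> is an outer
  product, projected to trace zero; that of \<open>u w\<close> is the last entry.\<close>

definition R :: "real^'n \<Rightarrow> real^'n \<Rightarrow> real^'n \<Rightarrow> real^'n" where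
  "R x y z = mk 0 ((((u x \<times> u y) \<bullet> u z) / 3) *\<^sub>R mat 1 - outer (u z) (u x \<times> u y))
                  ((m y *v u x - m x *v u y) \<times> u z - transpose (m z) *v (u x \<times> u y))"

lemma R_trace [simp]:
  "trace ((((a \<bullet> b) / 3) *\<^sub>R mat 1 - outer b a) :: real^3^3) = 0"
  by (simp add: trace_sub trace_scaleR trace_I inner_commute)

lemma g_R: "g (R x y z) w = A x y z w"
proof -
  have 1: "v \<times> u z \<bullet> u w = (u z \<times> u w) \<bullet> v" for v
    by (metis cross_triple inner_commute)
  have 2: "((u x \<times> u y) v* m z) \<bullet> u w = (u x \<times> u y) \<bullet> (m z *v u w)"
    by (rule dot_lmul_matrix)
  have 3: "trace ((((a \<bullet> b) / 3) *\<^sub>R mat 1 - outer b a) ** m w) = - (a \<bullet> (m w *v b))" for a b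
    by (simp add: matrix_diff_rdistrib trace_sub)
  show ?thesis
    by (simp add: g_def R_def A_def 1 2 3 inner_diff_left inner_diff_right)
qed

lemma curvature_operator_eq: "curvature_operator g A x y = R x y"
proof
  fix z
  show "curvature_operator g A x y z = R x y z"
    unfolding curvature_operator_def
  proof (rule the_equality)
    show "\<forall>w. g (R x y z) w = A x y z w" by (simp add: g_R)
    fix v assume "\<forall>w. g v w = A x y z w"
    then have "g (v - R x y z) w = 0" for w
      by (simp add: g_R bilinear_lsub[OF bilinear_g])
    then show "v = R x y z" using g_nondegenerate by fastforce
  qed
qed

lemma jacobi_operator_eq: "jacobi_operator g A x y = R y x x"
  by (simp add: jacobi_operator_def curvature_operator_eq)

lemma u_R [simp]: "u (R x y z) = 0"
  and m_R: "m (R x y z) = (((u x \<times> u y) \<bullet> u z) / 3) *\<^sub>R mat 1 - outer (u z) (u x \<times> u y)"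
  by (simp_all add: R_def)

lemma p_R: "p (R x y z) = (m y *v u x - m x *v u y) \<times> u z - (u x \<times> u y) v* m z"
  by (simp only: R_def p_mk R_trace transpose_matrix_vector)

text \<open>The inner operator lands in \<open>u = 0\<close> and the outer one then in
  \<open>m = 0\<close>, so this component is the whole product of two operators. It involves only
  U-parts.\<close>

lemma p_R_R: "p (R x1 x2 (R x3 x4 z)) = ((u x1 \<times> u x2) \<bullet> u z) *\<^sub>R (u x3 \<times> u x4)
       - (((u x3 \<times> u x4) \<bullet> u z) / 3) *\<^sub>R (u x1 \<times> u x2)"
  by (simp add: p_R m_R vec_matrix_mult_minus vec_matrix_mult_scaleR inner_commute)

lemma m_R_R [simp]: "m (R x1 x2 (R x3 x4 z)) = 0"
  by (simp add: m_R)

section \<open>Commutation properties of the operators\<close>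

lemma jacobi_tsankov: "jacobi_tsankov g A"
proof -
  have "R (R z y y) x x = R (R z x x) y y" for x y z
  proof (rule eqI)
    have *: "m (R (R z y y) x x) = 0" for x y z
      by (simp add: m_R)
    show "m (R (R z y y) x x) = m (R (R z x x) y y)"
      by (simp add: *)
    \<comment> \<open>Exchanging \<open>x\<close> and \<open>y\<close> reverses the sign of both the
      triple product and the cross product, so the value is symmetric.\<close>
    have *: "p (R (R z y y) x x) = ((u z \<times> u y) \<bullet> u x) *\<^sub>R (u y \<times> u x)" for x y z
      by (simp add: p_R[of "R z y y"] m_R dot_cross_self inner_commute cross_mult_left matrix_vector_mult_diff_rdistrib)
    show "p (R (R z y y) x x) = p (R (R z x x) y y)"
      using cross_skew[of "u x" "u y"] cross_triple[of "u z" "u y" "u x"] cross_triple[of "u z" "u x" "u y"]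
      by (simp add: *)
  qed simp
  then show ?thesis
    by (auto simp: jacobi_tsankov_def jacobi_operator_eq fun_eq_iff)
qed

lemma mixed_tsankov: "mixed_tsankov g A"
proof -
  have "R x y (R w z z) = R (R x y w) z z" for x y z w
  proof (rule eqI)
    have "m (R (R x y w) z z) = 0" for x y z
      by (simp add: m_R)
    then show "m (R x y (R w z z)) = m (R (R x y w) z z)"
      by simp
    \<comment> \<open>The scalar part of the inner matrix contributes a multiple of
      \<open>u z \<times> u z = 0\<close>.\<close>
    have "p (R (R x y w) z z) = ((u x \<times> u y) \<bullet> u z) *\<^sub>R (u w \<times> u z)"
      by (simp add: p_R[of "R x y w"] m_R scaleR_mult_vec cross_mult_left matrix_vector_mult_diff_rdistrib
          Cross3.left_diff_distrib)
    moreover have "p (R x y (R w z z)) = ((u x \<times> u y) \<bullet> u z) *\<^sub>R (u w \<times> u z)"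
      by (simp add: p_R m_R dot_cross_self vec_matrix_mult_minus inner_commute)
    ultimately show "p (R x y (R w z z)) = p (R (R x y w) z z)"
      by simp
  qed simp
  then show ?thesis
    by (auto simp: mixed_tsankov_def jacobi_operator_eq curvature_operator_eq fun_eq_iff)
qed

lemma not_skew_tsankov: "\<not> skew_tsankov g A"
proof
  assume "skew_tsankov g A"
  define a where "a i = mk (axis i 1) 0 0" for i
  \<comment> \<open>By \<open>p_R_R\<close> the left side is \<open>axis 1 1\<close>, while the
    right side is -1/3 of it.\<close>
  have "p (R (a 1) (a 2) (R (a 2) (a 3) (a 3))) = p (R (a 2) (a 3) (R (a 1) (a 2) (a 3)))"
    using \<open>skew_tsankov g A\<close>
    by (auto simp: skew_tsankov_def curvature_operator_eq fun_eq_iff)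
  then show False
    by (simp add: p_R_R a_def cross_basis inner_axis_axis)
      (auto simp: vec_eq_iff axis_def dest: spec[of _ 1])
qed

lemma not_two_step_nilpotent: "\<not> two_step_jacobi_nilpotent g A"
proof
  assume "two_step_jacobi_nilpotent g A"
  define a where "a i = mk (axis i 1) 0 0" for i
  \<comment> \<open>The left side is a product of two factors with a minus sign each, namely
    \<open>axis 3 1\<close>.\<close>
  have "p (R (R (a 3) (a 2) (a 2)) (a 1) (a 1)) = p 0"
    using \<open>two_step_jacobi_nilpotent g A\<close>
    by (metis (mono_tags, lifting) two_step_jacobi_nilpotent_def jacobi_operator_eq comp_apply)
  then show False
    by (simp add: p_R[of "R _ _ _"] m_R a_def cross_basis matrix_vector_mult_diff_rdistrib
        scaleR_mult_vec inner_axis_axis cross_mult_left Cross3.left_diff_distrib axis_eq_0_iff)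
qed

end

section \<open>The Lie algebra of the unipotent symmetries\<close>

text \<open>The identification of alternating forms on R^3 with vectors.\<close>

definition axial :: "(real^3 \<Rightarrow> real^3 \<Rightarrow> real) \<Rightarrow> real^3" where
  "axial k = vector [k (axis 2 1) (axis 3 1), k (axis 3 1) (axis 1 1), k (axis 1 1) (axis 2 1)]"

lemma vec3_expand: "a = a $ 1 *\<^sub>R axis 1 1 + a $ 2 *\<^sub>R axis 2 1 + a $ 3 *\<^sub>R (axis 3 1 :: real^3)"
  by (simp add: vec_eq_iff forall_3 axis_def)

text \<open>Both sides are bilinear and alternating, so three pairs of basis vectors decide.\<close>

lemma axial_inner_cross:
  assumes k: "bilinear k" and alt: "\<And>a. k a a = 0"
  shows "axial k \<bullet> (a \<times> b) = k a b"
proof -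
  have skew: "k x y = - k y x" for x y
  proof -
    have "k (x + y) (x + y) = k x y + k y x"
      by (simp add: bilinear_ladd[OF k] bilinear_radd[OF k] alt[of x] alt[of y])
    with alt[of "x + y"] show ?thesis by linarith
  qed
  have "k a b = k (a $ 1 *\<^sub>R axis 1 1 + a $ 2 *\<^sub>R axis 2 1 + a $ 3 *\<^sub>R axis 3 1)
     (b $ 1 *\<^sub>R axis 1 1 + b $ 2 *\<^sub>R axis 2 1 + b $ 3 *\<^sub>R axis 3 1)"
    using vec3_expand[of a] vec3_expand[of b] by simp
  then show ?thesis
    unfolding axial_def
    by (simp add: bilinear_ladd[OF k] bilinear_radd[OF k] bilinear_lmul[OF k] bilinear_rmul[OF k] alt
        skew[of "axis 2 1" "axis 1 1"] skew[of "axis 3 1" "axis 2 1"] skew[of "axis 1 1" "axis 3 1"]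
        cross3_def inner_vec_def sum_3 algebra_simps)
qed

lemma linear_axial:
  assumes "\<And>a b. linear (\<lambda>x. k x a b)"
  shows "linear (\<lambda>x. axial (k x))"
  by (rule linearI)
    (simp_all add: axial_def vec_eq_iff forall_3 linear_add[OF assms] linear_cmul[OF assms])

text \<open>A parameter \<open>(D, Q, s)\<close> encodes a symmetric bilinear map and the vector \<open>s\<close>: the columns of
  \<open>D\<close> are the values at the pairs $(1,1)$, $(2,2)$, $(3,3)$ of basis vectors, those of \<open>Q\<close> the values
  at $(2,3)$, $(1,3)$, $(1,2)$.\<close>

type_synonym param = "(real^3^3) \<times> (real^3^3) \<times> (real^3)"

definition sym_map :: "param \<Rightarrow> real^3 \<Rightarrow> real^3 \<Rightarrow> real^3" where
  "sym_map q z w = fst q *v vector [z$1 * w$1, z$2 * w$2, z$3 * w$3]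
     + fst (snd q) *v vector [z$2 * w$3 + z$3 * w$2, z$1 * w$3 + z$3 * w$1, z$1 * w$2 + z$2 * w$1]"

text \<open>Represents the functional sending a to the trace of
  \<open>\<lambda>z. sym_map q z a\<close>.\<close>

definition sym_trace :: "param \<Rightarrow> real^3" where
  "sym_trace q = (\<chi> k. \<Sum>i\<in>UNIV. sym_map q (axis i 1) (axis k 1) $ i)"

text \<open>The correction term is the only alternating one of the form $t \times (z \times w)$ that makes
  the values traceless.\<close>

definition sl3_map :: "param \<Rightarrow> real^3 \<Rightarrow> real^3^3" where
  "sl3_map q a = (\<chi> i j. sym_map q (axis j 1) a $ i
     - 1/2 * ((sym_trace q \<bullet> a) * (if i = j then 1 else 0) - sym_trace q $ j * a $ i))"

lemma bilinear_sym_map: "bilinear (sym_map q)"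
  unfolding bilinear_def sym_map_def
  by (intro conjI allI linearI)
    (simp_all add: vec_eq_iff forall_3 matrix_vector_mult_def sum_3 algebra_simps)

lemma sym_map_commute: "sym_map q z w = sym_map q w z"
  by (simp add: sym_map_def mult_ac add_ac)

lemma linear_sym_map: "linear (\<lambda>q. sym_map q z w)"
  unfolding sym_map_def
  by (rule linearI) (simp_all add: matrix_vector_mult_add_rdistrib scaleR_mult_vec scaleR_add_right)

lemma linear_sym_trace: "linear sym_trace"
  by (rule linearI)
    (simp_all add: sym_trace_def vec_eq_iff linear_add[OF linear_sym_map] linear_cmul[OF linear_sym_map]
      sum.distrib sum_distrib_left)

lemma bilinear_sl3_map: "bilinear sl3_map"
  unfolding bilinear_def
  by (intro conjI allI linearI)
    (simp_all add: sl3_map_def vec_eq_iff forall_3 bilinear_radd[OF bilinear_sym_map]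
      bilinear_rmul[OF bilinear_sym_map] linear_add[OF linear_sym_map] linear_cmul[OF linear_sym_map]
      linear_add[OF linear_sym_trace] linear_cmul[OF linear_sym_trace] inner_add_left inner_add_right
      algebra_simps)

lemmas sl3_map_simps =
  bilinear_ladd[OF bilinear_sl3_map] bilinear_radd[OF bilinear_sl3_map]
  bilinear_lmul[OF bilinear_sl3_map] bilinear_rmul[OF bilinear_sl3_map]
  bilinear_lzero[OF bilinear_sl3_map] bilinear_rzero[OF bilinear_sl3_map]

text \<open>By the Lagrange identity the subtracted term is half of
  \<open>sym_trace q \<times> (z \<times> a)\<close>. It is alternating in z and a, so the symmetric
  part is exactly \<open>sym_map q\<close>.\<close>

lemma sl3_map_mult: "sl3_map q a *v z = sym_map q z a - (1/2) *\<^sub>R ((sym_trace q \<bullet> a) *\<^sub>R z - (sym_trace q \<bullet> z) *\<^sub>R a)"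
proof -
  have "sym_map q z a = z $ 1 *\<^sub>R sym_map q (axis 1 1) a + z $ 2 *\<^sub>R sym_map q (axis 2 1) a
          + z $ 3 *\<^sub>R sym_map q (axis 3 1) a"
    by (subst vec3_expand[of z]) (simp only: bilinear_ladd[OF bilinear_sym_map] bilinear_lmul[OF bilinear_sym_map])
  then show ?thesis
    by (simp add: vec_eq_iff forall_3 matrix_vector_mult_def sum_3 sl3_map_def inner_vec_def algebra_simps)
qed

text \<open>With t = \<open>sym_trace q\<close>, the symmetric part has trace t.a, and the
  correction subtracts (3 - 1)/2 times t.a.\<close>

lemma trace_sl3_map [simp]: "trace (sl3_map q a) = 0"
proof -
  have "(\<Sum>i\<in>UNIV. sym_map q (axis i 1) a $ i) = sym_trace q \<bullet> a"
    apply (subst (1) vec3_expand[of a])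
    apply (simp only: bilinear_radd[OF bilinear_sym_map] bilinear_rmul[OF bilinear_sym_map])
    apply (simp add: sym_trace_def inner_vec_def sum_3 algebra_simps)
    done
  then show ?thesis
    by (simp add: trace_def sl3_map_def sum_3 inner_vec_def algebra_simps)
qed

text \<open>This is the condition on $L$ under which $1 + L$ leaves \<open>A\<close> invariant.\<close>

definition curv_inv :: "(real^3 \<Rightarrow> real^3^3) \<Rightarrow> bool" where
  "curv_inv L \<longleftrightarrow> (\<forall>x y z w. (x \<times> y) \<bullet> (L w *v z - L z *v w) + (z \<times> w) \<bullet> (L y *v x - L x *v y) = 0)"

text \<open>The symmetric part cancels in the commutator, leaving -t \<times> (z \<times> w). The
  condition then says that the triple product of \<open>x \<times> y\<close>, t,
  \<open>z \<times> w\<close> changes sign when its outer entries are exchanged.\<close>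

lemma curv_inv_sl3_map: "curv_inv (sl3_map q)"
proof -
  have sl3_map_comm: "sl3_map q w *v z - sl3_map q z *v w = - (sym_trace q \<times> (z \<times> w))" for z w
    unfolding sl3_map_mult
    by (simp add: sym_map_commute[of q z w] Lagrange inner_commute vec_eq_iff) (simp add: field_simps)
  have *: "(x \<times> y) \<bullet> (c \<times> (z \<times> w)) + (z \<times> w) \<bullet> (c \<times> (x \<times> y)) = 0" for x y z w c
    using cross_triple[of "x \<times> y" c "z \<times> w"] cross_skew[of "z \<times> w" "x \<times> y"]
    by (metis (no_types, lifting) add.inverse_inverse add.right_inverse cross_skew cross_triple inner_commute inner_minus_left inner_minus_right)
  have "(x \<times> y) \<bullet> - (c \<times> (z \<times> w)) + (z \<times> w) \<bullet> - (c \<times> (x \<times> y)) = 0" for x y z w c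
    using *[of x y c z w] by simp
  then show ?thesis
    by (simp only: curv_inv_def sl3_map_comm) blast
qed

text \<open>Symmetrizing removes the correction and recovers \<open>sym_map q\<close>, whose values
  on basis pairs are the columns of the two matrices.\<close>

lemma sl3_map_inj:
  assumes "\<And>a. sl3_map q a = 0" shows "fst q = 0" "fst (snd q) = 0"
proof -
  have *: "sym_map q z w = 0" for z w
  proof -
    have "sl3_map q z *v w + sl3_map q w *v z = 2 *\<^sub>R sym_map q z w"
      unfolding sl3_map_mult by (simp add: sym_map_commute[of q w z] scaleR_2 algebra_simps)
    then show ?thesis by (simp add: assms)
  qed
  show "fst q = 0" "fst (snd q) = 0"
    using *[of "axis 1 1" "axis 1 1"] *[of "axis 2 1" "axis 2 1"] *[of "axis 3 1" "axis 3 1"]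
      *[of "axis 1 1" "axis 2 1"] *[of "axis 2 1" "axis 3 1"] *[of "axis 3 1" "axis 1 1"]
    by (simp_all add: sym_map_def axis_def vec_eq_iff forall_3 matrix_vector_mult_def sum_3)
qed

text \<open>The symmetric part of (z,w) |-> L(w)z supplies \<open>D\<close> and \<open>Q\<close>;
  invariance and tracelessness force the alternating part. The vector \<open>s\<close> stays free,
  to be chosen in \<open>kernel_T\<close>.\<close>

lemma sl3_map_exhaust:
  assumes L: "linear L" and tr: "\<And>a. trace (L a) = 0" and inv: "curv_inv L"
  obtains D Q where "\<And>a s. L a = sl3_map (D, Q, s) a"
proof -
  define l where "l k i j = L (axis k 1) $ i $ j" for k i j
  have t: "l k 1 1 + l k 2 2 + l k 3 3 = 0" for k
    using tr[of "axis k 1"] by (simp add: trace_def sum_3 l_def)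
  have col: "c \<bullet> (L (axis k 1) *v axis j 1) = c $ 1 * l k 1 j + c $ 2 * l k 2 j + c $ 3 * l k 3 j" for c k j
    by (simp add: matrix_vector_mult_basis column_def l_def inner_vec_def sum_3)
  have ax: "axis i (1 :: real) $ j = (if j = i then 1 else 0)" for i j :: 3
    by (simp add: axis_def)
  have c: "(axis x 1 \<times> axis y 1) \<bullet> (L (axis w 1) *v axis z 1 - L (axis z 1) *v axis w 1)
     + (axis z 1 \<times> axis w 1) \<bullet> (L (axis y 1) *v axis x 1 - L (axis x 1) *v axis y 1) = 0" for x y z w
    using inv unfolding curv_inv_def by blast
  \<comment> \<open>The condition states that a bilinear form in \<open>x \<times> y\<close> and
    \<open>z \<times> w\<close> is antisymmetric; these are the six equations for its symmetric
    part, three diagonal and three mixed.\<close>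
  note c' = c[of 1 2 1 2] c[of 2 3 2 3] c[of 3 1 3 1] c[of 1 2 2 3] c[of 2 3 3 1] c[of 3 1 1 2]
  have eqs: "l 2 3 1 = l 1 3 2" "l 3 1 2 = l 2 1 3" "l 1 2 3 = l 3 2 1"
    "l 3 3 2 - l 2 3 3 + l 2 1 1 - l 1 1 2 = 0"
    "l 1 1 3 - l 3 1 1 + l 3 2 2 - l 2 2 3 = 0"
    "l 2 2 1 - l 1 2 2 + l 1 3 3 - l 3 3 1 = 0"
    using c' by (simp_all add: inner_diff_right col cross_basis ax)
  define D :: "real^3^3" where "D = (\<chi> i j. l j i j)"
  define Q :: "real^3^3" where "Q = (\<chi> i j. if j = 1 then (l 2 i 3 + l 3 i 2) / 2
     else if j = 2 then (l 1 i 3 + l 3 i 1) / 2 else (l 1 i 2 + l 2 i 1) / 2)"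
  have *: "L (axis k 1) = sl3_map (D, Q, s) (axis k 1)" for k s
  proof -
    have "l k i j = sl3_map (D, Q, s) (axis k 1) $ i $ j" for i j
      using eqs t[of 1] t[of 2] t[of 3] exhaust_3[of k] exhaust_3[of i] exhaust_3[of j]
      apply (simp add: sl3_map_def sym_trace_def sym_map_def axis_def D_def Q_def matrix_vector_mult_def
          sum_3 inner_vec_def)
      apply (elim disjE)
      apply (simp_all add: field_simps)
      done
    then show ?thesis by (simp add: l_def vec_eq_iff)
  qed
  have "L a = sl3_map (D, Q, s) a" for a s
    by (subst (1 2) vec3_expand[of a])
      (simp only: linear_add[OF L] linear_cmul[OF L] sl3_map_simps *[of _ s])
  then show ?thesis using that by blast
qed

section \<open>The groups of the exact sequence\<close>

lemma group_model_group: "group (model_group g A)"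
proof (rule groupI)
  show "\<one>\<^bsub>model_group g A\<^esub> \<in> carrier (model_group g A)"
    by (auto simp: model_group_def invertible_def intro!: exI[of _ "mat 1"])
  show "\<exists>S\<in>carrier (model_group g A). S \<otimes>\<^bsub>model_group g A\<^esub> T = \<one>\<^bsub>model_group g A\<^esub>"
    if T: "T \<in> carrier (model_group g A)" for T
  proof -
    obtain S where S: "T ** S = mat 1" "S ** T = mat 1"
      using T by (auto simp: model_group_def invertible_def)
    have TS: "T *v (S *v x) = x" for x
      by (simp add: matrix_vector_mul_assoc S)
    have "g (S *v x) (S *v y) = g x y" for x y
      using T TS by (simp add: model_group_def) (metis TS)
    moreover have "A (S *v x) (S *v y) (S *v z) (S *v w) = A x y z w" for x y z w
      using T TS by (simp add: model_group_def) (metis TS)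
    moreover have "invertible S"
      using S by (auto simp: invertible_def)
    ultimately have "S \<in> carrier (model_group g A)"
      by (simp add: model_group_def)
    then show ?thesis using S by (auto simp: model_group_def)
  qed
qed (auto simp: model_group_def matrix_mul_assoc invertible_mult matrix_vector_mul_assoc[symmetric])

lemma group_SL_pm: "group (SL_pm :: (real^'n^'n) monoid)"
proof (rule groupI)
  show "\<exists>C\<in>carrier SL_pm. C \<otimes>\<^bsub>SL_pm\<^esub> B = \<one>\<^bsub>SL_pm\<^esub>"
    if B: "B \<in> carrier (SL_pm :: (real^'n^'n) monoid)" for B
  proof -
    obtain C where C: "B ** C = mat 1" "C ** B = mat 1"
      using B by (auto simp: SL_pm_def invertible_def)
    then have "det B * det C = 1"
      by (metis det_I det_mul)
    then have "C \<in> carrier SL_pm"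
      using B C by (auto simp: SL_pm_def invertible_def minus_equation_iff)
    then show ?thesis using C by (auto simp: SL_pm_def)
  qed
  show "\<one>\<^bsub>SL_pm\<^esub> \<in> carrier SL_pm"
    by (auto simp: SL_pm_def invertible_def intro!: exI[of _ "mat 1"])
qed (auto simp: SL_pm_def matrix_mul_assoc invertible_mult det_mul)

text \<open>Double brackets vanish in either slot, so both ways of associating give the sum of the
  three elements and their three pairwise brackets; -x inverts x because the bracket
  alternates.\<close>

lemma group_class_two_group:
  assumes "class_two_bracket \<omega>" shows "group (class_two_group \<omega>)"
proof (rule groupI)
  have b: "bilinear \<omega>" and alt: "\<omega> x x = 0" and nil: "\<omega> (\<omega> x y) z = 0" for x y z
    using assms by (auto simp: class_two_bracket_def)
  have skew: "\<omega> x y = - \<omega> y x" for x y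
  proof -
    have "\<omega> (x + y) (x + y) = \<omega> x y + \<omega> y x"
      by (simp add: bilinear_ladd[OF b] bilinear_radd[OF b] alt[of x] alt[of y])
    with alt[of "x + y"] show ?thesis by (simp add: eq_neg_iff_add_eq_0)
  qed
  have nil': "\<omega> z (\<omega> x y) = 0" for x y z
    using skew[of z "\<omega> x y"] nil by simp
  show "x \<otimes>\<^bsub>class_two_group \<omega>\<^esub> y \<otimes>\<^bsub>class_two_group \<omega>\<^esub> z =
      x \<otimes>\<^bsub>class_two_group \<omega>\<^esub> (y \<otimes>\<^bsub>class_two_group \<omega>\<^esub> z)" for x y z
    by (simp add: class_two_group_def bilinear_ladd[OF b] bilinear_radd[OF b] nil nil')
  show "\<one>\<^bsub>class_two_group \<omega>\<^esub> \<otimes>\<^bsub>class_two_group \<omega>\<^esub> x = x" for x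
    by (simp add: class_two_group_def bilinear_lzero[OF b])
  show "\<exists>y\<in>carrier (class_two_group \<omega>). y \<otimes>\<^bsub>class_two_group \<omega>\<^esub> x = \<one>\<^bsub>class_two_group \<omega>\<^esub>" for x
    by (simp add: class_two_group_def) (metis add.left_inverse add_0 alt bilinear_lneg[OF b] neg_0_equal_iff_equal)
qed (auto simp: class_two_group_def)

section \<open>The bracket on parameters\<close>

definition coadj :: "param \<Rightarrow> real^3^3 \<Rightarrow> real^3" where
  "coadj q M = (\<chi> k. trace (M ** sl3_map q (axis k 1)))"

text \<open>The defining property of the adjoint with respect to the trace form:
  \<open>coadj q\<close> is the map written with a dagger in the overview.\<close>

lemma inner_coadj: "coadj q M \<bullet> a = trace (M ** sl3_map q a)"
  apply (subst (2) vec3_expand[of a])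
  apply (simp add: sl3_map_simps coadj_def inner_vec_def sum_3 matrix_add_ldistrib trace_add trace_scaleR_mult)
  done

lemma bilinear_coadj: "bilinear coadj"
  unfolding bilinear_def
  by (intro conjI allI linearI)
    (simp_all add: coadj_def vec_eq_iff sl3_map_simps matrix_add_ldistrib matrix_add_rdistrib trace_add trace_scaleR_mult)

lemmas coadj_simps =
  bilinear_ladd[OF bilinear_coadj] bilinear_radd[OF bilinear_coadj]
  bilinear_lmul[OF bilinear_coadj] bilinear_rmul[OF bilinear_coadj]
  bilinear_lzero[OF bilinear_coadj] bilinear_rzero[OF bilinear_coadj]

text \<open>The defect between \<open>E q \<circ> E r\<close> and \<open>E (q + r)\<close> in the
  dual part at U-component a, paired with b. Being alternating, it has the form (s \<times> a).b, so
  a shift of \<open>s\<close> absorbs it.\<close>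

definition bracket_form :: "param \<Rightarrow> param \<Rightarrow> real^3 \<Rightarrow> real^3 \<Rightarrow> real" where
  "bracket_form q r a b =
     (trace (sl3_map r a ** sl3_map q b) - trace (sl3_map q a ** sl3_map r b)) / 2"

definition bracket :: "param \<Rightarrow> param \<Rightarrow> param" where
  "bracket q r = (0, 0, axial (bracket_form q r))"

lemma linear_bracket_form:
  "linear (\<lambda>q. bracket_form q r a b)" "linear (\<lambda>r. bracket_form q r a b)"
  "linear (\<lambda>a. bracket_form q r a b)" "linear (\<lambda>b. bracket_form q r a b)"
  unfolding bracket_form_def
  by (rule linearI; simp add: sl3_map_simps matrix_add_ldistrib matrix_add_rdistrib trace_add
      trace_scaleR_mult field_simps)+

lemma sl3_map_eq_0: "fst q = 0 \<Longrightarrow> fst (snd q) = 0 \<Longrightarrow> sl3_map q a = 0"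
proof -
  assume q: "fst q = 0" "fst (snd q) = 0"
  have *: "sym_map q z w = 0" for z w
    by (simp add: sym_map_def q)
  then have "sym_trace q = 0"
    by (simp add: sym_trace_def vec_eq_iff)
  with * show ?thesis
    by (simp add: sl3_map_def) (simp add: vec_eq_iff)
qed

lemma bracket_form_same: "bracket_form q r a a = 0"
  using trace_mul_sym[of "sl3_map q a" "sl3_map r a"] by (simp add: bracket_form_def)

text \<open>Brackets are computed from \<open>sl3_map\<close>, which vanishes on brackets since only
  their \<open>s\<close>-entry can be non-zero.\<close>

lemma class_two_bracket_bracket: "class_two_bracket bracket"
  unfolding class_two_bracket_def
proof (intro conjI allI)
  have 1: "linear (\<lambda>q. axial (bracket_form q r))" and 2: "linear (\<lambda>q. axial (bracket_form r q))" for r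
    by (rule linear_axial, rule linear_bracket_form)+
  show "bilinear bracket"
    unfolding bilinear_def bracket_def
    by (intro conjI allI linearI)
      (simp_all add: linear_add[OF 1] linear_add[OF 2] linear_cmul[OF 1] linear_cmul[OF 2])
  show "bracket q q = 0" for q
    by (simp add: bracket_def axial_def bracket_form_def zero_prod_def vec_eq_iff forall_3)
  show "bracket (bracket q r) t = 0" for q r t
  proof -
    have "sl3_map (bracket q r) = (\<lambda>_. 0)"
      by (auto simp: bracket_def intro!: sl3_map_eq_0)
    then show ?thesis
      by (simp add: bracket_def[of "bracket q r"] axial_def bracket_form_def zero_prod_def vec_eq_iff forall_3)
  qed
qed

lemma eq_0_if_cross_inner_eq_0:
  assumes "\<And>a b. (a \<times> b) \<bullet> v = 0" shows "v = 0"
  using assms[of "axis 1 1" "axis 2 1"] assms[of "axis 2 1" "axis 3 1"] assms[of "axis 3 1" "axis 1 1"]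
  by (simp add: cross_basis inner_axis' vec_eq_iff forall_3)

section \<open>The symmetry group\<close>

context sl3_model
begin

text \<open>The exponential of $N$.\<close>

definition E :: "param \<Rightarrow> real^'n \<Rightarrow> real^'n" where
  "E q x = mk (u x) (m x + sl3_map q (u x))
     (p x + coadj q (m x) + snd (snd q) \<times> u x + (1/2) *\<^sub>R coadj q (sl3_map q (u x)))"

lemma u_E [simp]: "u (E q x) = u x"
  and m_E [simp]: "m (E q x) = m x + sl3_map q (u x)"
  and p_E [simp]: "p (E q x) = p x + coadj q (m x) + snd (snd q) \<times> u x + (1/2) *\<^sub>R coadj q (sl3_map q (u x))"
  by (simp_all add: E_def trace_add)

lemma linear_E: "linear (E q)"
  by (rule linearI; rule eqI)
    (simp_all add: sl3_map_simps coadj_simps cross_add_right cross_mult_right scaleR_add_right scaleR_add_left)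

lemma E_E: "E q (E r x) = E (q + r + bracket q r) x"
proof (rule eqI)
  have *: "sl3_map (bracket q r) a = 0" for a
    by (auto simp: bracket_def intro!: sl3_map_eq_0)
  have "coadj (bracket q r) M = 0" for M
    by (simp add: coadj_def * vec_eq_iff)
  note simps = * this
  show "m (E q (E r x)) = m (E (q + r + bracket q r) x)"
    by (simp add: sl3_map_simps *)
  have "p (E q (E r x)) \<bullet> b = p (E (q + r + bracket q r) x) \<bullet> b" for b
  proof -
    have "(snd (snd (bracket q r)) \<times> u x) \<bullet> b = bracket_form q r (u x) b"
    proof -
      have "bilinear (bracket_form q r)"
        using linear_bracket_form by (auto simp: bilinear_def)
      from axial_inner_cross[OF this bracket_form_same]
      show ?thesis by (simp add: bracket_def) (metis cross_triple inner_commute)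
    qed
    then show ?thesis
      by (simp add: sl3_map_simps coadj_simps simps cross_add_left inner_add_left inner_coadj bracket_form_def field_simps)
  qed
  then show "p (E q (E r x)) = p (E (q + r + bracket q r) x)"
    using vector_eq_rdot by blast
qed simp

text \<open>The \<open>coadj\<close> terms cancel the mixed trace terms, the map s \<times> is skew,
  and the quadratic term with factor 1/2 occurs twice and cancels the trace of the two
  \<open>sl3_map\<close> values.\<close>

lemma g_E: "g (E q x) (E q y) = g x y"
  using dot_cross_det[of "snd (snd q)" "u x" "u y"] 
    cross_triple[of "snd (snd q)" "u x" "u y"] cross_triple[of "u x" "u y" "snd (snd q)"]
    cross_triple[of "snd (snd q)" "u y" "u x"] cross_triple[of "u y" "u x" "snd (snd q)"]
    cross_skew[of "u x" "u y"]
    trace_mul_sym[of "m y" "sl3_map q (u x)"] trace_mul_sym[of "sl3_map q (u y)" "sl3_map q (u x)"]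
  by (simp add: g_def inner_add_left inner_coadj matrix_add_ldistrib matrix_add_rdistrib trace_add)

text \<open>The change in \<open>A\<close> is precisely the \<open>curv_inv\<close> expression for
  \<open>sl3_map q\<close>.\<close>

lemma A_E: "A (E q x) (E q y) (E q z) (E q w) = A x y z w"
  using curv_inv_sl3_map[of q] unfolding curv_inv_def
  by (simp add: A_def matrix_vector_mult_add_rdistrib inner_add_right inner_diff_right)
    (smt (verit))

lemma matrix_apply: "linear T \<Longrightarrow> matrix T *v x = T (x :: real^'n)" for T :: "real^'n \<Rightarrow> real^'n"
  by (simp add: matrix_vector_mul)

text \<open>Invertibility is automatic: preserving a non-degenerate form makes \<open>T\<close>
  injective.\<close>

lemma matrix_mem_model_group:
  assumes T: "linear T" and g: "\<And>x y. g (T x) (T y) = g x y"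
    and A: "\<And>x y z w. A (T x) (T y) (T z) (T w) = A x y z w"
  shows "matrix T \<in> carrier (model_group g A)"
proof -
  have "inj T"
  proof (rule injI)
    fix x y assume "T x = T y"
    then have "g x z = g y z" for z by (metis g)
    then have "g (x - y) z = 0" for z by (simp add: bilinear_lsub[OF bilinear_g])
    then show "x = y" using g_nondegenerate by fastforce
  qed
  then have "invertible (matrix T)"
    using matrix_left_invertible_injective[of "matrix T"] invertible_left_inverse[of "matrix T"]
    by (simp add: matrix_apply[OF T, abs_def])
  then show ?thesis
    by (simp add: model_group_def matrix_apply[OF T] g A)
qed

text \<open>On U the \<open>m\<close>-component recovers the symmetric parameters; the
  \<open>p\<close>-component then recovers \<open>s\<close>, since no non-zero vector has zero cross
  product with everything.\<close>

lemma E_inj: "E q = E r \<Longrightarrow> q = r"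
proof -
  assume eq: "E q = E r"
  have 1: "sl3_map (q - r) a = 0" for a
  proof -
    have "m (E q (mk a 0 0)) = m (E r (mk a 0 0))" using eq by simp
    then show ?thesis by (simp add: bilinear_lsub[OF bilinear_sl3_map])
  qed
  have "fst q = fst r" "fst (snd q) = fst (snd r)"
    using sl3_map_inj[of "q - r", OF 1] by auto
  moreover have "snd (snd q) = snd (snd r)"
  proof -
    have "sl3_map q = sl3_map r" using 1 by (auto simp: bilinear_lsub[OF bilinear_sl3_map])
    then have c: "coadj q = coadj r" by (auto simp: coadj_def fun_eq_iff)
    have "(snd (snd q) - snd (snd r)) \<times> a = 0" for a
    proof -
      have "p (E q (mk a 0 0)) = p (E r (mk a 0 0))" using eq by simp
      then show ?thesis by (simp add: c \<open>sl3_map q = sl3_map r\<close> Cross3.left_diff_distrib)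
    qed
    then show ?thesis
      by (metis cross_basis_nonzero cross_eq_0 eq_iff_diff_eq_0)
  qed
  ultimately show "q = r" by (simp add: prod_eq_iff)
qed

text \<open>Describes the dual of U intrinsically, as the kernel of \<open>A\<close>, so that every
  symmetry must preserve it.\<close>

lemma u_eq_0_m_eq_0_iff: "u x = 0 \<and> m x = 0 \<longleftrightarrow> (\<forall>y z w. A x y z w = 0)"
proof
  assume A: "\<forall>y z w. A x y z w = 0"
  have "(a \<times> b) \<bullet> (m x *v c) = 0" for a b c
    using A[rule_format, of "mk c 0 0" "mk a 0 0" "mk b 0 0"] by (simp add: A_def)
  then have "m x *v c = 0" for c
    by (rule eq_0_if_cross_inner_eq_0)
  then have mx: "m x = 0"
    by (metis matrix_eq matrix_vector_mult_0)
  have "(a \<times> b) \<bullet> (M *v u x) = 0" if "trace M = 0" for a b M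
    using A[rule_format, of "mk 0 M 0" "mk a 0 0" "mk b 0 0"] that by (simp add: A_def)
  then have *: "M *v u x = 0" if "trace M = 0" for M
    using that by (intro eq_0_if_cross_inner_eq_0)
  have "u x = 0"
    \<comment> \<open>Each of these elementary matrices isolates one coordinate of
      \<open>u x\<close>.\<close>
    using *[of "outer (axis 1 1) (axis 2 1)"] *[of "outer (axis 2 1) (axis 3 1)"] *[of "outer (axis 3 1) (axis 1 1)"]
    by (simp add: inner_axis_axis inner_axis' axis_eq_0_iff vec_eq_iff[of "u x"] forall_3)
      (simp add: axis_def)
  with mx show "u x = 0 \<and> m x = 0" by simp
qed (simp add: A_def)

text \<open>The subspace \<open>u = 0\<close> is the orthogonal complement of the kernel of
  \<open>A\<close>, hence also preserved by symmetries.\<close>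

lemma u_eq_0_iff: "u x = 0 \<longleftrightarrow> (\<forall>y. u y = 0 \<and> m y = 0 \<longrightarrow> g x y = 0)"
proof
  assume "\<forall>y. u y = 0 \<and> m y = 0 \<longrightarrow> g x y = 0"
  then have "g x (mk 0 0 (u x)) = 0" by simp
  then show "u x = 0" by (simp add: g_def)
qed (simp add: g_def)

section \<open>The map induced on U\<close>

definition h :: "real^'n^'n \<Rightarrow> real^3^3" where
  "h T = matrix (\<lambda>a. u (T *v mk a 0 0))"

abbreviation "\<G> \<equiv> model_group g A"

lemma linear_mk0: "linear (\<lambda>a. mk a 0 0)"
  by (rule linear_mk) (auto simp: linear_iff)

lemma h_mult: "h T *v a = u (T *v mk a 0 0)"
proof -
  have "linear (\<lambda>a. u (T *v mk a 0 0))"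
    by (intro linear_compose[OF linear_compose[OF linear_mk0], of "(*v) T" u, unfolded o_def] linear_u matrix_vector_mul_linear)
  then show ?thesis
    unfolding h_def by (simp add: matrix_vector_mul)
qed

context
  fixes T assumes T: "T \<in> carrier \<G>"
begin

lemma g_T: "g (T *v x) (T *v y) = g x y"
  and A_T: "A (T *v x) (T *v y) (T *v z) (T *v w) = A x y z w"
  using T by (simp_all add: model_group_def)

lemma surj_T: obtains y where "x = T *v y"
  using T by (metis (no_types, lifting) matrix_vector_mul_assoc matrix_vector_mul_lid model_group_def
      invertible_def mem_Collect_eq partial_object.select_convs(1))

lemma um_T: "u (T *v x) = 0 \<and> m (T *v x) = 0 \<longleftrightarrow> u x = 0 \<and> m x = 0"
  unfolding u_eq_0_m_eq_0_iff by (metis A_T surj_T)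

lemma u_T_eq_0: "u x = 0 \<Longrightarrow> u (T *v x) = 0"
proof (subst u_eq_0_iff, intro allI impI)
  fix k assume x: "u x = 0" and k: "u k = 0 \<and> m k = 0"
  obtain y where y: "k = T *v y" by (rule surj_T)
  then have "u y = 0 \<and> m y = 0" using k um_T by blast
  then have "g x y = 0" using x u_eq_0_iff by blast
  then show "g (T *v x) k = 0" by (simp add: y g_T)
qed

text \<open>Vectors with equal \<open>u\<close> differ by an element of the preserved subspace
  \<open>u = 0\<close>; so \<open>h T\<close> is the map induced on the quotient, independent of the
  lift \<open>mk a 0 0\<close>.\<close>

lemma u_T: "u (T *v x) = h T *v u x"
proof -
  have "u (T *v (x - mk (u x) 0 0)) = 0"
    by (rule u_T_eq_0) simp
  then show ?thesis by (simp add: h_mult matrix_vector_mult_diff_distrib)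
qed

lemma triple_T:
  assumes "u w = 0"
  shows "((h T *v a) \<times> (h T *v b)) \<bullet> (m (T *v w) *v (h T *v c)) = (a \<times> b) \<bullet> (m w *v c)"
  using A_T[of "mk a 0 0" "mk b 0 0" "mk c 0 0" w] assms
  by (simp add: A_def u_T)

lemma invertible_h_T: "\<exists>S. h T ** S = mat 1 \<and> S ** h T = mat 1"
proof -
  have "surj ((*v) (h T))"
  proof (rule surjI)
    \<comment> \<open>A preimage of \<open>a\<close> comes from a \<open>T\<close>-preimage of its
      lift.\<close>
    show "h T *v u (SOME y. mk a 0 0 = T *v y) = a" for a
      using surj_T[of "mk a 0 0"] by (metis (mono_tags, lifting) someI_ex trace_zero u_T u_mk)
  qed
  then show ?thesis
    by (metis matrix_left_right_inverse matrix_right_invertible_surjective)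
qed

text \<open>The action on sl(3) from the overview, solved for the original matrix:
  \<open>triple_T\<close> determines \<open>m w\<close>, because cross products span R^3.\<close>

lemma m_T:
  assumes S: "h T ** S = mat 1" "S ** h T = mat 1" and w: "u w = 0"
  shows "m w = det (h T) *\<^sub>R (S ** m (T *v w) ** h T)"
proof -
  define P where "P = h T"
  have PS: "P *v (S *v x) = x" for x
    using S by (simp add: matrix_vector_mul_assoc P_def)
  have "det P *\<^sub>R (S *v (m (T *v w) *v (P *v c))) = m w *v c" for c
  proof -
    have "(a \<times> b) \<bullet> (det P *\<^sub>R (S *v (m (T *v w) *v (P *v c))) - m w *v c) = 0" for a b
    proof -
      \<comment> \<open>\<open>cross_matrix_mult\<close> says that the transpose of P takes Pa
        \<times> Pb to det(P) times a \<times> b.\<close>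
      have "(det P *\<^sub>R (a \<times> b)) \<bullet> (S *v (m (T *v w) *v (P *v c)))
          = ((P *v a) \<times> (P *v b)) \<bullet> (P *v (S *v (m (T *v w) *v (P *v c))))"
        unfolding cross_matrix_mult[symmetric] by (simp add: dot_lmul_matrix)
      also have "\<dots> = (a \<times> b) \<bullet> (m w *v c)"
        unfolding PS using triple_T[OF w] by (simp add: P_def)
      finally show ?thesis by (simp add: inner_diff_right)
    qed
    then show ?thesis
      using eq_0_if_cross_inner_eq_0 by (metis eq_iff_diff_eq_0)
  qed
  then show ?thesis
    by (simp add: matrix_eq P_def scaleR_mult_vec matrix_vector_mul_assoc[symmetric])
qed

lemma h_T_mem: "h T \<in> carrier SL_pm"
proof -
  obtain S where S: "h T ** S = mat 1" "S ** h T = mat 1"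
    using invertible_h_T by blast
  \<comment> \<open>A traceless test matrix with non-zero trace of its square; comparing that trace
    before and after \<open>T\<close> leaves det^2 = 1.\<close>
  define M where "M = outer (axis 1 1) (axis 2 1) + outer (axis 2 1) (axis 1 1)"
  define w where "w = mk 0 M 0"
  have M: "trace M = 0" "trace (M ** M) = 2"
    by (simp_all add: M_def trace_add inner_axis_axis matrix_add_rdistrib trace_scaleR matrix_vector_mult_add_rdistrib inner_add_right)
  have w: "u w = 0" "m w = M" using M by (simp_all add: w_def)
  define N where "N = m (T *v w)"
  have "trace (M ** M) = (det (h T))\<^sup>2 * trace ((S ** N ** h T) ** (S ** N ** h T))"
    using m_T[OF S w(1)] by (simp add: w N_def trace_scaleR_mult power2_eq_square)
  also have "(S ** N ** h T) ** (S ** N ** h T) = S ** (N ** N ** h T)"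
    by (metis (no_types, opaque_lifting) S matrix_mul_assoc matrix_mul_rid)
  also have "trace (S ** (N ** N ** h T)) = trace (N ** N)"
    by (metis S(1) matrix_mul_assoc matrix_mul_rid trace_mul_sym)
  also have "trace (N ** N) = trace (M ** M)"
    using g_T[of w w] w u_T_eq_0[OF w(1)] by (simp add: g_def N_def)
  finally have "(det (h T))\<^sup>2 = 1" using M by simp
  then have "det (h T) = 1 \<or> det (h T) = -1" by (simp add: power2_eq_1_iff)
  then show ?thesis
    using S by (auto simp: SL_pm_def invertible_def)
qed

text \<open>The images of the lifts \<open>mk a 0 0\<close> determine \<open>T\<close>: their
  \<open>m\<close>-parts give \<open>L\<close>, hence \<open>D\<close> and \<open>Q\<close>, and
  their \<open>p\<close>-parts give \<open>s\<close>.\<close>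

lemma kernel_T:
  assumes id: "h T = mat 1" obtains q where "\<And>x. T *v x = E q x"
proof -
  define L where "L a = m (T *v mk a 0 0)" for a
  define c where "c a = p (T *v mk a 0 0)" for a
  have linL: "linear L" unfolding L_def
    by (intro linear_compose[OF linear_compose[OF linear_mk0], of "(*v) T" m, unfolded o_def] linear_m matrix_vector_mul_linear)
  have linc: "linear c" unfolding c_def
    by (intro linear_compose[OF linear_compose[OF linear_mk0], of "(*v) T" p, unfolded o_def] linear_p matrix_vector_mul_linear)
  have uT: "u (T *v x) = u x" for x
    by (simp add: u_T id)
  have mT: "m (T *v x) = m x + L (u x)" for x
  proof -
    have "m (x - mk (u x) 0 0) = m (T *v (x - mk (u x) 0 0))"
      using m_T[of "mat 1" "x - mk (u x) 0 0"] by (simp add: id)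
    then show ?thesis by (simp add: L_def matrix_vector_mult_diff_distrib)
  qed
  have trL: "trace (L a) = 0" for a by (simp add: L_def)
  have inv: "curv_inv L"
    unfolding curv_inv_def
  proof (intro allI)
    fix x y z w
    show "(x \<times> y) \<bullet> (L w *v z - L z *v w) + (z \<times> w) \<bullet> (L y *v x - L x *v y) = 0"
      using A_T[of "mk x 0 0" "mk y 0 0" "mk z 0 0" "mk w 0 0"]
      by (simp add: A_def uT mT inner_diff_right)
  qed
  obtain D Q where DQ: "\<And>a s. L a = sl3_map (D, Q, s) a"
    by (rule sl3_map_exhaust[OF linL trL inv]) blast
  \<comment> \<open>For \<open>E q\<close> this difference is (s \<times> a).b. It alternates
    because \<open>T\<close> keeps the lifts isotropic, so \<open>axial k\<close> is the required
    \<open>s\<close>.\<close>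
  define k where "k a b = c a \<bullet> b - trace (L a ** L b) / 2" for a b
  have k: "bilinear k"
    unfolding bilinear_def k_def
    by (intro conjI allI linearI)
      (simp_all add: linear_add[OF linL] linear_add[OF linc] linear_cmul[OF linL] linear_cmul[OF linc]
        inner_add_left inner_add_right matrix_add_ldistrib matrix_add_rdistrib trace_add
        trace_scaleR_mult field_simps)
  have k0: "k a a = 0" for a
    using g_T[of "mk a 0 0" "mk a 0 0"] by (simp add: g_def uT mT k_def c_def)
  define q where "q = (D, Q, axial k)"
  have L: "L = sl3_map q" unfolding q_def using DQ by auto
  have "T *v x = E q x" for x
  proof (rule eqI)
    have "p (T *v x) \<bullet> b = p (E q x) \<bullet> b" for b
    proof -
      \<comment> \<open>Pairing with the image of a lift determines the remaining component of
        \<open>T *v x\<close>.\<close>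
      have "p (T *v x) \<bullet> b + c b \<bullet> u x - trace ((m x + L (u x)) ** L b) = p x \<bullet> b"
        using g_T[of x "mk b 0 0"] by (simp add: g_def uT mT c_def)
      moreover have "c b \<bullet> u x = axial k \<bullet> (b \<times> u x) + trace (L (u x) ** L b) / 2"
        using axial_inner_cross[OF k k0, of b "u x"] trace_mul_sym[of "L b" "L (u x)"] k_def[of b "u x"] by simp
      moreover have "axial k \<bullet> (b \<times> u x) = - ((axial k \<times> u x) \<bullet> b)"
        using cross_skew[of b "u x"] cross_triple[of "axial k" "u x" b]
        by (metis cross_triple inner_commute inner_minus_right)
      ultimately show ?thesis
        by (simp add: L inner_add_left inner_coadj matrix_add_rdistrib trace_add) (simp add: q_def)
    qed
    then show "p (T *v x) = p (E q x)" using vector_eq_rdot by blast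
  qed (simp_all add: uT mT L)
  then show ?thesis using that by blast
qed

end

lemma h_mem_epi: "h \<in> epi \<G> SL_pm"
proof -
  have "h (T ** S) = h T ** h S" if "T \<in> carrier \<G>" for T S
    by (simp add: matrix_eq h_mult[of "T ** S"] h_mult[of S] matrix_vector_mul_assoc[symmetric] u_T[OF that])
  moreover have "\<exists>T\<in>carrier \<G>. h T = P" if P: "P \<in> carrier SL_pm" for P
  proof -
    obtain S where S: "P ** S = mat 1" "S ** P = mat 1"
      using P by (auto simp: SL_pm_def invertible_def)
    have PS: "P *v (S *v x) = x" "S *v (P *v x) = x" for x
      using S by (simp_all add: matrix_vector_mul_assoc)
    have d: "det P * det P = 1"
      using P by (auto simp: SL_pm_def)
    \<comment> \<open>The factor \<open>det P\<close> equals its own inverse, matching the action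
      that \<open>m_T\<close> forces.\<close>
    define F where "F M = det P *\<^sub>R (P ** M ** S)" for M
    have trF: "trace (F M) = det P * trace M" for M
      unfolding F_def trace_scaleR by (metis S(2) matrix_mul_assoc matrix_mul_rid trace_mul_sym)
    have "F M ** F N = P ** M ** N ** S" for M N
    proof -
      have "F M ** F N = (det P * det P) *\<^sub>R (P ** M ** (S ** P) ** N ** S)"
        by (simp add: F_def matrix_eq scaleR_mult_vec matrix_vector_mult_scaleR matrix_vector_mul_assoc[symmetric])
      then show ?thesis by (simp add: d S)
    qed
    then have trFF: "trace (F M ** F N) = trace (M ** N)" for M N
      by (metis S(2) matrix_mul_assoc matrix_mul_rid trace_mul_sym)
    have linF: "linear F"
      unfolding F_def
      by (rule linearI) (simp_all add: matrix_eq scaleR_mult_vec matrix_vector_mult_scaleR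
          matrix_vector_mul_assoc[symmetric] matrix_vector_mult_add_rdistrib matrix_vector_right_distrib
          scaleR_add_right)
    define T where "T x = mk (P *v u x) (F (m x)) (transpose S *v p x)" for x
    have T: "u (T x) = P *v u x" "m (T x) = F (m x)" "p (T x) = transpose S *v p x" for x
      by (simp_all add: T_def trF)
    have lin: "linear T"
      by (rule linearI; rule eqI)
        (simp_all only: T lin_simps linear_add[OF linF] linear_cmul[OF linF] matrix_vector_right_distrib
          matrix_vector_mult_scaleR)
    have "g (T x) (T y) = g x y" for x y
      by (simp add: g_def T trFF dot_lmul_matrix PS)
    \<comment> \<open>The factor from the cross product cancels the one in \<open>F\<close>.\<close>
    moreover have "((P *v a) \<times> (P *v b)) \<bullet> (F M *v (P *v c)) = (a \<times> b) \<bullet> (M *v c)" for a b c M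
    proof -
      have "((P *v a) \<times> (P *v b)) \<bullet> (F M *v (P *v c))
          = det P * ((transpose P *v ((P *v a) \<times> (P *v b))) \<bullet> (M *v c))"
        by (simp add: F_def scaleR_mult_vec matrix_vector_mul_assoc[symmetric] PS dot_lmul_matrix)
      then show ?thesis unfolding cross_matrix_mult by (simp add: d mult.assoc[symmetric])
    qed
    then have "A (T x) (T y) (T z) (T w) = A x y z w" for x y z w
      by (simp add: A_def T)
    ultimately have "matrix T \<in> carrier \<G>"
      using matrix_mem_model_group[OF lin] by blast
    moreover have "h (matrix T) = P"
      by (simp add: matrix_eq h_mult matrix_apply[OF lin] T)
    ultimately show ?thesis by blast
  qed
  ultimately show ?thesis
    using h_T_mem by (fastforce simp: epi_def hom_def model_group_def SL_pm_def)
qed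

section \<open>Continuity and exactness\<close>

lemma continuous_h: "continuous_on X h"
proof -
  have "linear h"
    by (rule linearI)
      (simp_all add: matrix_eq h_mult matrix_vector_mult_add_rdistrib scaleR_mult_vec)
  then show ?thesis by (rule linear_continuous_on[OF linear_conv_bounded_linear[THEN iffD1]])
qed

lemma continuous_matrix_E:
  assumes "linear \<phi>"
  shows "continuous_on (X :: (real^'k) set) (\<lambda>x. matrix (E (\<phi> x)))"
proof -
  have \<phi>: "continuous_on X \<phi>"
    using assms by (rule linear_continuous_on[OF linear_conv_bounded_linear[THEN iffD1]])
  have "continuous_on X (\<lambda>x. E (\<phi> x) v)" for v
  proof -
    let ?N = "\<lambda>q. mk 0 (sl3_map q (u v)) (coadj q (m v) + snd (snd q) \<times> u v)"
    let ?C = "\<lambda>q. coadj q (sl3_map q (u v))"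
    have "linear ?N"
      by (rule linear_mk; (rule linearI)?)
        (auto simp: sl3_map_simps coadj_simps cross_add_left cross_mult_left scaleR_add_right)
    then have 1: "continuous_on X (\<lambda>x. ?N (\<phi> x))"
      using continuous_on_compose2[OF linear_continuous_on[OF linear_conv_bounded_linear[THEN iffD1]] \<phi>] by blast
    have "linear (\<lambda>q. sl3_map q (u v))"
      using bilinear_sl3_map by (simp add: bilinear_def)
    then have "continuous_on X (\<lambda>x. sl3_map (\<phi> x) (u v))"
      using continuous_on_compose2[OF linear_continuous_on[OF linear_conv_bounded_linear[THEN iffD1]] \<phi>] by blast
    then have C: "continuous_on X (\<lambda>x. ?C (\<phi> x))"
      by (rule bilinear_continuous_on_compose[OF \<phi> _ bilinear_coadj])
    have "linear (\<lambda>b. mk 0 0 ((1/2) *\<^sub>R b))"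
      by (rule linear_mk; (rule linearI)?) (auto simp: scaleR_add_right)
    then have 2: "continuous_on X (\<lambda>x. mk 0 0 ((1/2) *\<^sub>R ?C (\<phi> x)))"
      using continuous_on_compose2[OF linear_continuous_on[OF linear_conv_bounded_linear[THEN iffD1]] C] by blast
    \<comment> \<open>\<open>E\<close> is polynomial in the parameter: a constant, a linear and a
      quadratic term.\<close>
    have "E q v = v + ?N q + mk 0 0 ((1/2) *\<^sub>R ?C q)" for q
      by (rule eqI) simp_all
    then show ?thesis using 1 2 by (simp add: continuous_on_add)
  qed
  then show ?thesis
    unfolding matrix_def by (intro continuous_on_vec_lambda continuous_on_component)
qed

lemma short_exact_sequence:
  "\<exists>(\<omega> :: real^21 \<Rightarrow> real^21 \<Rightarrow> real^21) f.
     class_two_bracket \<omega> \<and> group_short_exact (class_two_group \<omega>) f \<G> h SL_pm \<and> continuous_on UNIV f"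
proof -
  \<comment> \<open>Parameters have dimension 9 + 9 + 3 = 21; the bracket is transported along a
    linear isomorphism.\<close>
  obtain \<phi> :: "real^21 \<Rightarrow> param" and \<psi> where lin: "linear \<phi>" "linear \<psi>"
    and inv: "\<And>x. \<psi> (\<phi> x) = x" "\<And>q. \<phi> (\<psi> q) = q"
  proof -
    have "DIM(real^21) = DIM(param)" by simp
    then show ?thesis by (rule isomorphisms_UNIV_UNIV) (blast intro: that)
  qed
  define \<omega> where "\<omega> x y = \<psi> (bracket (\<phi> x) (\<phi> y))" for x y
  define f where "f x = matrix (E (\<phi> x))" for x
  have b: "bilinear bracket" and b0: "bracket q q = 0" and bb: "bracket (bracket q r) s = 0" for q r s
    using class_two_bracket_bracket unfolding class_two_bracket_def by blast+
  have \<omega>: "class_two_bracket \<omega>"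
    unfolding class_two_bracket_def
  proof (intro conjI allI)
    show "bilinear \<omega>"
      unfolding bilinear_def \<omega>_def
      by (intro conjI allI linearI)
        (simp_all add: linear_add[OF lin(1)] linear_add[OF lin(2)] linear_cmul[OF lin(1)] linear_cmul[OF lin(2)]
          bilinear_ladd[OF b] bilinear_radd[OF b] bilinear_lmul[OF b] bilinear_rmul[OF b])
  qed (simp_all add: \<omega>_def b0 bb inv linear_0[OF lin(2)])
  have f_apply: "f x *v v = E (\<phi> x) v" for x v
    by (simp add: f_def matrix_apply[OF linear_E])
  have f_mem: "f x \<in> carrier \<G>" for x
    unfolding f_def by (rule matrix_mem_model_group) (auto simp: linear_E g_E A_E)
  have "f \<in> mon (class_two_group \<omega>) \<G>"
  proof -
    have "f (x + y + \<omega> x y) = f x ** f y" for x y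
      by (simp add: matrix_eq f_apply matrix_vector_mul_assoc[symmetric] E_E \<omega>_def inv linear_add[OF lin(1)])
    moreover have "inj f"
    proof (rule injI)
      fix x y assume "f x = f y"
      then have "E (\<phi> x) = E (\<phi> y)" by (metis f_apply ext)
      then show "x = y" by (metis E_inj inv(1))
    qed
    ultimately show ?thesis
      using f_mem by (auto simp: mon_def hom_def class_two_group_def model_group_def)
  qed
  moreover have "f ` carrier (class_two_group \<omega>) = kernel \<G> SL_pm h"
  proof -
    have "h (f x) = mat 1" for x
      by (simp add: matrix_eq h_mult f_apply)
    moreover have "T \<in> range f" if T: "T \<in> carrier \<G>" "h T = mat 1" for T
    proof -
      obtain q where "\<And>x. T *v x = E q x" using kernel_T[OF T] by blast
      then have "T = f (\<psi> q)" by (simp add: matrix_eq f_apply inv)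
      then show ?thesis by blast
    qed
    ultimately show ?thesis
      using f_mem by (auto simp: kernel_def class_two_group_def SL_pm_def)
  qed
  ultimately have "group_short_exact (class_two_group \<omega>) f \<G> h SL_pm"
    unfolding group_short_exact_def
    using group_class_two_group[OF \<omega>] group_model_group group_SL_pm h_mem_epi by blast
  moreover have "continuous_on UNIV f"
    unfolding f_def by (rule continuous_matrix_E[OF lin(1)])
  ultimately show ?thesis using \<omega> by blast
qed

end

section \<open>Coordinates on $M_{14}$\<close>

lemma UNIV_idx14:
  "(UNIV :: idx14 set) = {\<alpha>1, \<alpha>2, \<alpha>3, \<alpha>s1, \<alpha>s2, \<alpha>s3, \<beta>11, \<beta>12, \<beta>21, \<beta>22, \<beta>31, \<beta>32, \<beta>41, \<beta>42}"
  using idx14.exhaust by blast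

instance idx14 :: finite
  by standard (simp add: UNIV_idx14)

locale idx14_basis =
  fixes e :: "idx14 \<Rightarrow> real^'n"
  assumes inj: "inj e" and indep: "independent (range e)" and span: "span (range e) = UNIV"
begin

lemma linear_coord: "linear (coord e i)"
  unfolding coord_def
  by (rule linearI)
    (use indep span in \<open>auto simp: real_vector.representation_add real_vector.representation_scale\<close>)

lemma coord_basis: "coord e i (e j) = (if i = j then 1 else 0)"
  unfolding coord_def using representation_basis[OF indep, of "e j"] inj by (auto simp: inj_eq)

lemma expand: "x = (\<Sum>i\<in>UNIV. coord e i x *\<^sub>R e i)"
proof -
  have "x = (\<Sum>b\<in>range e. representation (range e) x b *\<^sub>R b)"
    using sum_representation_eq[OF indep, of x "range e"] span by (simp add: UNIV_idx14)
  then show ?thesis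
    by (subst (asm) sum.reindex[OF inj]) (simp add: coord_def)
qed

lemma coord_sum: "coord e i (\<Sum>j\<in>UNIV. c j *\<^sub>R e j) = c i"
proof -
  have "coord e i (\<Sum>j\<in>UNIV. c j *\<^sub>R e j) = (\<Sum>j\<in>UNIV. c j * (if i = j then 1 else 0))"
    by (simp add: linear_sum[OF linear_coord] linear_cmul[OF linear_coord] coord_basis)
  also have "\<dots> = c i" by (simp add: UNIV_idx14) (cases i; simp)
  finally show ?thesis .
qed

definition u :: "real^'n \<Rightarrow> real^3" where
  "u x = vector [coord e \<alpha>1 x, coord e \<alpha>2 x, coord e \<alpha>3 x]"

definition p :: "real^'n \<Rightarrow> real^3" where
  "p x = vector [coord e \<alpha>s1 x, coord e \<alpha>s2 x, coord e \<alpha>s3 x]"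

text \<open>The matrix attached to each $\beta_{i,j}$ is read off from $A(x,y,z,M) = \mathrm{vol}(x,y,Mz)$.\<close>

definition m :: "real^'n \<Rightarrow> real^3^3" where
  "m x = vector [
     vector [- (coord e \<beta>42 x / 2), - coord e \<beta>32 x, coord e \<beta>22 x],
     vector [coord e \<beta>31 x, coord e \<beta>41 x / 2, - coord e \<beta>11 x],
     vector [- coord e \<beta>21 x, coord e \<beta>12 x, coord e \<beta>42 x / 2 - coord e \<beta>41 x / 2]]"

text \<open>Inverts \<open>u\<close>, \<open>m\<close> and \<open>p\<close>. Entry (3,3) of
  \<open>M\<close> is left to the trace condition.\<close>

definition mk :: "real^3 \<Rightarrow> real^3^3 \<Rightarrow> real^3 \<Rightarrow> real^'n" where
  "mk a M b = (\<Sum>i\<in>UNIV. (case i of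
       \<alpha>1 \<Rightarrow> a $ 1 | \<alpha>2 \<Rightarrow> a $ 2 | \<alpha>3 \<Rightarrow> a $ 3
     | \<alpha>s1 \<Rightarrow> b $ 1 | \<alpha>s2 \<Rightarrow> b $ 2 | \<alpha>s3 \<Rightarrow> b $ 3
     | \<beta>11 \<Rightarrow> - M $ 2 $ 3 | \<beta>12 \<Rightarrow> M $ 3 $ 2 | \<beta>21 \<Rightarrow> - M $ 3 $ 1 | \<beta>22 \<Rightarrow> M $ 1 $ 3
     | \<beta>31 \<Rightarrow> M $ 2 $ 1 | \<beta>32 \<Rightarrow> - M $ 1 $ 2
     | \<beta>41 \<Rightarrow> 2 * M $ 2 $ 2 | \<beta>42 \<Rightarrow> - 2 * M $ 1 $ 1) *\<^sub>R e i)"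

sublocale sl3_model u m p mk
proof (rule sl3_model.intro)
  show "linear u"
    by (rule linearI)
      (simp_all add: u_def vec_eq_iff forall_3 linear_add[OF linear_coord] linear_cmul[OF linear_coord])
  show "linear p"
    by (rule linearI)
      (simp_all add: p_def vec_eq_iff forall_3 linear_add[OF linear_coord] linear_cmul[OF linear_coord])
  show "linear m"
    by (rule linearI)
      (simp_all add: m_def vec_eq_iff forall_3 linear_add[OF linear_coord]
        linear_cmul[OF linear_coord] field_simps)
  show "trace (m x) = 0" for x
    by (simp add: trace_def sum_3 m_def)
  show "u (mk a M b) = a" "p (mk a M b) = b" for a M b
    by (simp_all add: u_def p_def mk_def coord_sum vec_eq_iff forall_3)
  show "m (mk a M b) = M" if "trace M = 0" for a M b
    using that by (simp add: m_def mk_def coord_sum vec_eq_iff forall_3 trace_def sum_3)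
  show "x = y" if "u x = u y" "m x = m y" "p x = p y" for x y
  proof -
    have "coord e i x = coord e i y" for i
      using that by (cases i) (simp_all add: u_def m_def p_def vec_eq_iff forall_3)
    then show ?thesis using expand[of x] expand[of y] by simp
  qed
qed

text \<open>With a, b the coordinates along \<beta>41 and \<beta>42, the diagonal -b/2, a/2, (b-a)/2
  of \<open>m x\<close> gives -a^2/2 - b^2/2 + ab/2, the quadratic form with Gram entries -1/2,
  -1/2, 1/4.\<close>

lemma M14_form_eq: "M14_form e = g"
  by (intro ext)
    (simp add: M14_form_def g_def form_component_def u_def p_def m_def inner_vec_def sum_3
      trace_def matrix_matrix_mult_def field_simps)

lemma M14_curvature_eq: "M14_curvature e = A"
proof (intro ext)
  show "M14_curvature e x y z w = A x y z w" for x y z w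
    apply (simp only: M14_curvature_def A_def curvature_component_def u_def m_def inner_vec_def sum_3
       cross3_def matrix_vector_mult_def vec_lambda_beta vector_3 inner_real_def)
    apply (simp add: field_simps)
    done
qed

section \<open>The signature\<close>

lemma has_signature: "has_signature (M14_form e) 8 6"
proof -
  \<comment> \<open>Six hyperbolic pairs contribute (6,6), through differences and sums. The plane
    of \<beta>41, \<beta>42 is negative definite; the coefficient 2 makes its second vector
    orthogonal to the first.\<close>
  define v where "v i = (case i of
       \<alpha>1 \<Rightarrow> e \<alpha>1 - e \<alpha>s1 | \<alpha>2 \<Rightarrow> e \<alpha>2 - e \<alpha>s2 | \<alpha>3 \<Rightarrow> e \<alpha>3 - e \<alpha>s3
     | \<alpha>s1 \<Rightarrow> e \<alpha>1 + e \<alpha>s1 | \<alpha>s2 \<Rightarrow> e \<alpha>2 + e \<alpha>s2 | \<alpha>s3 \<Rightarrow> e \<alpha>3 + e \<alpha>s3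
     | \<beta>11 \<Rightarrow> e \<beta>11 - e \<beta>12 | \<beta>21 \<Rightarrow> e \<beta>21 - e \<beta>22 | \<beta>31 \<Rightarrow> e \<beta>31 - e \<beta>32
     | \<beta>12 \<Rightarrow> e \<beta>11 + e \<beta>12 | \<beta>22 \<Rightarrow> e \<beta>21 + e \<beta>22 | \<beta>32 \<Rightarrow> e \<beta>31 + e \<beta>32
     | \<beta>41 \<Rightarrow> e \<beta>41 | \<beta>42 \<Rightarrow> e \<beta>41 + 2 *\<^sub>R e \<beta>42)" for i
  define neg where "neg = {\<alpha>1, \<alpha>2, \<alpha>3, \<beta>11, \<beta>21, \<beta>31, \<beta>41, \<beta>42}"
  define pos where "pos = {\<alpha>s1, \<alpha>s2, \<alpha>s3, \<beta>12, \<beta>22, \<beta>32}"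
  let ?g = "M14_form e"
  have g: "bilinear ?g" unfolding M14_form_eq by (rule bilinear_g)
  have orth: "?g (v i) (v j) = 0" if "i \<noteq> j" for i j
    using that
    by (cases i; cases j; simp add: v_def M14_form_def form_component_def coord_basis
        linear_add[OF linear_coord] linear_diff[OF linear_coord] linear_cmul[OF linear_coord])
  have neg: "?g (v i) (v i) < 0" if "i \<in> neg" for i
    using that unfolding neg_def
    by (auto simp: v_def M14_form_def form_component_def coord_basis
        linear_add[OF linear_coord] linear_diff[OF linear_coord] linear_cmul[OF linear_coord])
  have pos: "?g (v i) (v i) > 0" if "i \<in> pos" for i
    using that unfolding pos_def
    by (auto simp: v_def M14_form_def form_component_def coord_basis
        linear_add[OF linear_coord] linear_diff[OF linear_coord] linear_cmul[OF linear_coord])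
  have UN: "neg \<union> pos = UNIV" by (auto simp: neg_def pos_def UNIV_idx14)
  then have nz: "?g (v i) (v i) \<noteq> 0" for i
    using neg[of i] pos[of i] by force
  \<comment> \<open>Equal values at distinct labels would be a vector that is both isotropic and
    non-isotropic.\<close>
  have inj_v: "inj v"
    by (rule injI) (metis nz orth)
  have lin: "linear (\<lambda>x. ?g x y)" for y
    using g by (simp add: bilinear_def)
  have ind: "independent (range v)"
  proof (rule independent_if_scalars_zero)
    show "finite (range v)" by simp
    fix f x assume 0: "(\<Sum>x\<in>range v. f x *\<^sub>R x) = 0" and x: "x \<in> range v"
    then obtain j where j: "x = v j" by blast
    have "0 = ?g (\<Sum>x\<in>range v. f x *\<^sub>R x) (v j)"
      unfolding 0 by (simp add: linear_0[OF lin])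
    also have "\<dots> = (\<Sum>i\<in>UNIV. f (v i) * ?g (v i) (v j))"
      by (subst sum.reindex[OF inj_v]) (simp add: linear_sum[OF lin] linear_cmul[OF lin])
    also have "\<dots> = f (v j) * ?g (v j) (v j)"
      by (rule trans[OF sum.cong[OF refl, of _ _ "\<lambda>i. if i = j then f (v j) * ?g (v j) (v j) else 0"]])
        (auto simp: orth)
    finally show "f x = 0" using nz j by simp
  qed
  have "card (range v) = card (range e)"
    using inj_v inj by (simp add: card_image)
  then have "span (range v) = UNIV"
    using card_ge_dim_independent[of "range v" UNIV] ind dim_eq_card[of "range e" UNIV] indep span
    by auto
  have R: "v ` neg \<union> v ` pos = range v" unfolding UN[symmetric] by blast
  have "card neg = 8" "card pos = 6"
    by (simp_all add: neg_def pos_def)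
  then have card: "card (v ` neg) = 8" "card (v ` pos) = 6"
    using inj_v by (simp_all add: card_image inj_on_subset)
  show ?thesis
    unfolding has_signature_def
  proof (intro exI conjI)
    show "card (v ` neg) = 8" "card (v ` pos) = 6" by (fact card)+
    show "independent (v ` neg \<union> v ` pos)" "span (v ` neg \<union> v ` pos) = UNIV"
      unfolding R by fact+
    show "\<forall>x\<in>v ` neg \<union> v ` pos. \<forall>y\<in>v ` neg \<union> v ` pos. x \<noteq> y \<longrightarrow> ?g x y = 0"
      unfolding R by (auto intro!: orth)
    show "\<forall>x\<in>v ` neg. ?g x x < 0" "\<forall>x\<in>v ` pos. ?g x x > 0"
      by (auto intro!: neg pos)
  qed simp_all
qed

end

text \<open>Once form and tensor are identified with \<open>g\<close> and \<open>A\<close> of the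
  abstract model, each conjunct is one of the results above. Continuity of \<open>f\<close> and
  \<open>h\<close> ties the sequence to the topologies.\<close>

theorem theorem1p4:
  fixes e :: "idx14 \<Rightarrow> real^14"
  assumes "inj e" and "independent (range e)" and "span (range e) = UNIV"
  shows
    "zero_model (M14_form e) (M14_curvature e) \<and>
     (jacobi_tsankov (M14_form e) (M14_curvature e) \<and> has_signature (M14_form e) 8 6) \<and>
     (\<not> two_step_jacobi_nilpotent (M14_form e) (M14_curvature e) \<and>
      \<not> skew_tsankov (M14_form e) (M14_curvature e)) \<and>
     (\<exists>(\<omega> :: real^21 \<Rightarrow> real^21 \<Rightarrow> real^21) (f :: real^21 \<Rightarrow> real^14^14) (h :: real^14^14 \<Rightarrow> real^3^3).
        class_two_bracket \<omega> \<and>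
        group_short_exact (class_two_group \<omega>) f
          (model_group (M14_form e) (M14_curvature e)) h SL_pm \<and>
        continuous_on UNIV f \<and>
        continuous_on (carrier (model_group (M14_form e) (M14_curvature e))) h) \<and>
     mixed_tsankov (M14_form e) (M14_curvature e)"
proof -
  interpret idx14_basis e
    using assms by unfold_locales
  show ?thesis
    using zero_model jacobi_tsankov has_signature not_two_step_nilpotent not_skew_tsankov mixed_tsankov
      short_exact_sequence continuous_h
    unfolding M14_form_eq M14_curvature_eq by blast
qed

end
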